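(* Let $(p_k)_{k\ge 0}$ be an offspring distribution with $p_0=0$, $p_k<1$ for all $k\ge 1$, and $m=\sum_{k\ge1}k p_k\in(1,\infty)$. For $\lambda\in(0,m)$ let $\mathbf{AGW}_\lambda$ be the $\lambda$-augmented Galton--Watson measure, and let $\nu^+(e)$ denote the number of children of the root of a tree minus $1$. Then, as $\lambda\to0^+$, $$\int\nu^+(e)\,\mathbf{AGW}_\lambda(\mathrm{d}T,\mathrm{d}\xi)\longrightarrow m.$$
   Context: $\mathbf{GW}$ is the law of the Galton--Watson tree with offspring distribution $(p_k)$, on the space $\mathcal{T}$ of infinite leafless rooted trees. $\nu(x)$ is the number of children of a vertex $x$. Fix $\lambda\in(0,m)$. The $\lambda$-biased random walk on a rooted tree is the nearest-neighbour Markov chain which from the root moves to a uniformly chosen child and from any other vertex $x$ moves to its parent with probability $\lambda/(\nu(x)+\lambda)$ and to each child with probability $1/(\nu(x)+\lambda)$. On a Galton--Watson tree it is a.s. transient for $\lambda<m$. When it is transient, the law of the infinite ray obtained by loop-erasing the trajectory of the walk started at the root is the $\lambda$-harmonic measure on the tree boundary (the set of infinite rays from the root). For $T\in\mathcal{T}$ with root $e$, let $T_*$ be the tree obtained by adding an extra vertex $e_*$ adjacent to $e$, with $T_*$ rooted at $e_*$. Let $\beta(T)=\beta_\lambda(T)$ be the probability that the $\lambda$-biased random walk on $T_*$ started at $e$ never visits $e_*$. Let $\mathcal{C}(T)=\mathcal{C}_\lambda(T)$ be the effective conductance from the root to infinity of $T$ when each edge between levels $n$ and $n+1$ has conductance $\lambda^{-n}$;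 equivalently $\mathcal{C}(T)=\lambda\beta(T)/(1-\beta(T))=\sum_{|u|=1}\beta(T_u)$, where $T_u$ is the subtree of descendants of $u$, rooted at $u$, and the sum is over children $u$ of the root. For $\mathbf{GW}$-a.e. $T$ one has $0<\beta(T)<1$, $\lambda-1+\beta(T)>0$ and $\lambda-1+\mathcal{C}(T)>0$. Let $\mathbb{T}$ and $\mathbb{T}^+$ be independent with law $\mathbf{GW}$, with roots $e$ and $e^+$, and let $\nu^+$ be the number of children of $e^+$ in $\mathbb{T}^+$. Let $\mathbb{T}\!-\!\!\bullet\,\mathbb{T}^+$ be the tree rooted at $e^+$ obtained by joining $e$ and $e^+$ by an edge (so its root has $\nu^++1$ children). Given $(\mathbb{T},\mathbb{T}^+)$, let $\mathcal{R}$ be a random ray in $\mathbb{T}$ distributed according to the $\lambda$-harmonic measure on $\partial\mathbb{T}$. The measure $\mathbf{AGW}_\lambda$ is the probability measure on trees with a marked ray $(T,\xi)$ that is absolutely continuous with respect to the law of $(\mathbb{T}\!-\!\!\bullet\,\mathbb{T}^+,\mathcal{R})$ with density $$c_\lambda^{-1}\,\frac{(\lambda+\nu^+)\beta(\mathbb{T})}{\lambda-1+\beta(\mathbb{T})+\mathcal{C}(\mathbb{T}^+)},\qquad c_\lambda=E\left[\frac{(\lambda+\nu^+)\beta(\mathbb{T})}{\lambda-1+\beta(\mathbb{T})+\mathcal{C}(\mathbb{T}^+)}\right].$$ Under $(\mathbb{T}\!-\!\!\bullet\,\mathbb{T}^+,\mathcal{R})$ the quantity $\nu^+(e)$ equals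 $\nu^+$. *)

theory Defs
  imports "HOL-Probability.Probability"
begin

section \<open>Rooted trees\<close>

text \<open>
  Vertices are finite words over the natural numbers (Ulam--Harris coding): the root is
  \<open>[]\<close>, the children of \<open>u\<close> are the words \<open>u @ [0]\<close>, ..., \<open>u @ [k - 1]\<close>, and the level of
  \<open>u\<close> is \<open>length u\<close>. The trees are locally finite and leafless, hence infinite.
\<close>

type_synonym vertex = "nat list"
type_synonym tree = "vertex set"
type_synonym ray = "nat \<Rightarrow> vertex"

definition trees :: "tree set" where
  "trees = {T. [] \<in> T \<and> (\<forall>u i. u @ [i] \<in> T \<longrightarrow> u \<in> T) \<and>
               (\<forall>u\<in>T. \<exists>k>0. {i. u @ [i] \<in> T} = {..<k})}"

definition children :: "tree \<Rightarrow> vertex \<Rightarrow> vertex set" where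
  "children T u = {v \<in> T. \<exists>i. v = u @ [i]}"

definition nu :: "tree \<Rightarrow> vertex \<Rightarrow> nat" where
  "nu T u = card (children T u)"

definition tree_space :: "tree measure" where
  "tree_space = sigma trees (range (\<lambda>u. {T \<in> trees. u \<in> T}))"

definition ray_space :: "ray measure" where
  "ray_space = (\<Pi>\<^sub>M n\<in>UNIV. count_space UNIV)"

section \<open>Galton--Watson trees\<close>

definition tree_of_counts :: "(vertex \<Rightarrow> nat) \<Rightarrow> tree" where
  "tree_of_counts n = {u. \<forall>k<length u. u ! k < n (take k u)}"

text \<open>
  The offspring numbers are i.i.d. with law \<open>p\<close>. The law \<open>p\<close> is viewed as a measure on the
  positive integers, so that every sample is a leafless tree; this is meant for
  \<open>pmf p 0 = 0\<close>, where no mass is lost.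
\<close>

definition GW :: "nat pmf \<Rightarrow> tree measure" where
  "GW p = distr (\<Pi>\<^sub>M u\<in>UNIV. restrict_space (measure_pmf p) {1..}) tree_space tree_of_counts"

section \<open>Markov chains\<close>

text \<open>
  The law on trajectories of the chain with transition kernel \<open>K\<close> started at \<open>x\<close>. It is
  realised by independent choices \<open>\<omega> (n, y)\<close> with law \<open>K y\<close>, where \<open>\<omega> (n, y)\<close> is the move
  made at time \<open>n\<close> when the chain is then at \<open>y\<close>. Lemma \<open>markov_chain_cylinder\<close> gives
  the finite-dimensional distributions.
\<close>

primrec trajectory :: "'s \<Rightarrow> (nat \<times> 's \<Rightarrow> 's) \<Rightarrow> nat \<Rightarrow> 's" where
  "trajectory x \<omega> 0 = x"
| "trajectory x \<omega> (Suc n) = \<omega> (n, trajectory x \<omega> n)"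

definition markov_chain :: "('s \<Rightarrow> 's pmf) \<Rightarrow> 's \<Rightarrow> (nat \<Rightarrow> 's) measure" where
  "markov_chain K x =
     distr (\<Pi>\<^sub>M (n, y)\<in>UNIV. measure_pmf (K y)) (\<Pi>\<^sub>M n\<in>UNIV. count_space UNIV) (trajectory x)"

lemma measurable_trajectory:
  fixes K :: "'s::countable \<Rightarrow> 's pmf"
  shows "trajectory x \<in> measurable (\<Pi>\<^sub>M (n, y)\<in>UNIV. measure_pmf (K y))
           (\<Pi>\<^sub>M n\<in>UNIV. count_space UNIV)"
proof -
  let ?M = "\<Pi>\<^sub>M (n::nat, y)\<in>UNIV. measure_pmf (K y)"
  have comp: "(\<lambda>\<omega>. \<omega> j) \<in> measurable ?M (count_space UNIV)" for j
    using measurable_component_singleton[of j UNIV "\<lambda>(n, y). measure_pmf (K y)"]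
    by (cases j) simp
  have "(\<lambda>\<omega>. trajectory x \<omega> n) \<in> measurable ?M (count_space UNIV)" for n
  proof (induction n)
    case (Suc n)
    show ?case
      unfolding trajectory.simps by (rule measurable_compose_countable[OF comp Suc])
  qed simp
  then show ?thesis
    by (intro measurable_PiM_single') (auto simp: PiE_UNIV_domain)
qed

lemma markov_chain_cylinder:
  fixes K :: "'s::countable \<Rightarrow> 's pmf"
  assumes "xs 0 = x"
  shows "measure (markov_chain K x) {X. \<forall>i\<le>n. X i = xs i} = (\<Prod>i<n. pmf (K (xs i)) (xs (Suc i)))"
proof -
  let ?F = "\<lambda>(n::nat, y). measure_pmf (K y)"
  let ?M = "PiM UNIV ?F"
  let ?J = "(\<lambda>i. (i, xs i)) ` {..<n}"
  let ?E = "\<lambda>j. {xs (Suc (fst j))}"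
  interpret P: product_prob_space ?F UNIV
    by (rule product_prob_spaceI) (auto simp: prob_space_measure_pmf split: prod.split)
  have sets: "{X. \<forall>i\<le>n. X i = xs i} \<in> sets (\<Pi>\<^sub>M n\<in>UNIV. count_space (UNIV :: 's set))"
  proof -
    have "{X \<in> space (\<Pi>\<^sub>M n\<in>UNIV. count_space (UNIV :: 's set)). \<forall>i\<in>{..n}. X i = xs i}
            \<in> sets (\<Pi>\<^sub>M n\<in>UNIV. count_space (UNIV :: 's set))"
      by measurable
    then show ?thesis by (simp add: space_PiM PiE_UNIV_domain Ball_def)
  qed
  have traj: "(\<forall>i\<le>k. trajectory x \<omega> i = xs i) \<longleftrightarrow> (\<forall>i<k. \<omega> (i, xs i) = xs (Suc i))" for \<omega> k
    using assms by (induction k) (auto simp: le_Suc_eq less_Suc_eq)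
  have space: "space ?M = UNIV"
    by (auto simp: space_PiM PiE_UNIV_domain)
  have pre: "trajectory x -` {X. \<forall>i\<le>n. X i = xs i} \<inter> space ?M = P.emb UNIV ?J (PiE ?J ?E)"
    using traj[of n] by (auto simp: prod_emb_def space space_PiM restrict_def PiE_def Pi_def extensional_def)
  have "measure (markov_chain K x) {X. \<forall>i\<le>n. X i = xs i} = measure ?M (P.emb UNIV ?J (PiE ?J ?E))"
    unfolding markov_chain_def measure_distr[OF measurable_trajectory sets] pre by simp
  also have "\<dots> = (\<Prod>j\<in>?J. measure (?F j) (?E j))"
    by (rule P.measure_PiM_emb) (auto simp: split_beta)
  also have "\<dots> = (\<Prod>i<n. pmf (K (xs i)) (xs (Suc i)))"
    by (subst prod.reindex) (auto simp: inj_on_def measure_pmf_single)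
  finally show ?thesis .
qed

section \<open>The biased random walk\<close>

definition biased_step :: "real \<Rightarrow> tree \<Rightarrow> vertex \<Rightarrow> vertex pmf" where
  "biased_step l T x =
     (if x = [] then pmf_of_set (children T x)
      else embed_pmf (\<lambda>y. if y = butlast x then l / (real (nu T x) + l)
                          else if y \<in> children T x then 1 / (real (nu T x) + l) else 0))"

definition biased_walk :: "real \<Rightarrow> tree \<Rightarrow> vertex \<Rightarrow> (nat \<Rightarrow> vertex) measure" where
  "biased_walk l T x = markov_chain (biased_step l T) x"

lemma finite_children: "T \<in> trees \<Longrightarrow> x \<in> T \<Longrightarrow> finite (children T x)"
  and children_nonempty: "T \<in> trees \<Longrightarrow> x \<in> T \<Longrightarrow> children T x \<noteq> {}"
proof -
  assume "T \<in> trees" "x \<in> T"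
  then obtain k where k: "k > 0" "{i. x @ [i] \<in> T} = {..<k}"
    by (auto simp: trees_def)
  have "children T x = (\<lambda>i. x @ [i]) ` {i. x @ [i] \<in> T}"
    by (auto simp: children_def)
  then show "finite (children T x)" "children T x \<noteq> {}"
    using k by auto
qed

lemma pmf_biased_step:
  assumes "T \<in> trees" "x \<in> T" "x \<noteq> []" "l > 0"
  shows "pmf (biased_step l T x) y =
           (if y = butlast x then l / (real (nu T x) + l)
            else if y \<in> children T x then 1 / (real (nu T x) + l) else 0)"
proof -
  let ?f = "\<lambda>y. if y = butlast x then l / (real (nu T x) + l)
                else if y \<in> children T x then 1 / (real (nu T x) + l) else 0"
  let ?A = "insert (butlast x) (children T x)"
  note fin = finite_children[OF assms(1,2)]
  have nin: "butlast x \<notin> children T x"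
  proof
    assume "butlast x \<in> children T x"
    then obtain i where "butlast x = x @ [i]" by (auto simp: children_def)
    then have "length (butlast x) = Suc (length x)" by simp
    then show False by simp
  qed
  have nonneg: "?f y \<ge> 0" for y using assms(4) by auto
  have "(\<integral>\<^sup>+ y. ennreal (?f y) \<partial>count_space UNIV) = (\<Sum>y\<in>?A. ennreal (?f y))"
    using fin by (intro nn_integral_count_space') auto
  also have "\<dots> = ennreal (\<Sum>y\<in>?A. ?f y)"
    using nonneg by (intro sum_ennreal) auto
  also have "(\<Sum>y\<in>?A. ?f y) = l / (real (nu T x) + l) + (\<Sum>y\<in>children T x. 1 / (real (nu T x) + l))"
    using fin nin by (subst sum.insert) (auto intro!: sum.cong simp del: sum_constant)
  also have "\<dots> = 1"
    using assms(4) by (simp add: nu_def flip: add_divide_distrib)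
  finally show ?thesis
    using assms(3) nonneg by (simp add: biased_step_def pmf_embed_pmf)
qed

text \<open>
  Loop erasure: the \<open>(k + 1)\<close>-st vertex retained is the one that the trajectory moves to
  after its last visit to the \<open>k\<close>-th vertex retained. This is meant for trajectories visiting
  each vertex finitely often (otherwise \<open>Max\<close> is applied to an infinite set).
\<close>

definition last_visit :: "(nat \<Rightarrow> 's) \<Rightarrow> 's \<Rightarrow> nat" where
  "last_visit X v = Max {n. X n = v}"

primrec loop_erasure_time :: "(nat \<Rightarrow> 's) \<Rightarrow> nat \<Rightarrow> nat" where
  "loop_erasure_time X 0 = last_visit X (X 0)"
| "loop_erasure_time X (Suc k) = last_visit X (X (Suc (loop_erasure_time X k)))"

definition loop_erasure :: "(nat \<Rightarrow> 's) \<Rightarrow> nat \<Rightarrow> 's" where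
  "loop_erasure X k = X (loop_erasure_time X k)"

definition harmonic_measure :: "real \<Rightarrow> tree \<Rightarrow> ray measure" where
  "harmonic_measure l T = distr (biased_walk l T []) ray_space loop_erasure"

text \<open>\<open>T\<^sub>*\<close>: the new root is \<open>[]\<close>, and its only child, the old root, is \<open>[0]\<close>.\<close>

definition star_tree :: "tree \<Rightarrow> tree" where
  "star_tree T = insert [] ((#) 0 ` T)"

definition beta :: "real \<Rightarrow> tree \<Rightarrow> real" where
  "beta l T = measure (biased_walk l (star_tree T) [0]) {X. \<forall>n. X n \<noteq> []}"

section \<open>Effective conductance\<close>

text \<open>
  A network is given by its conductances \<open>c x y = c y x\<close>, with \<open>c x y = 0\<close> if there is no
  edge. The effective conductance from \<open>a\<close> to infinity is the total conductance at \<open>a\<close> times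
  the probability that the associated random walk started at \<open>a\<close> never returns to \<open>a\<close>.
\<close>

definition total_conductance :: "('v \<Rightarrow> 'v \<Rightarrow> real) \<Rightarrow> 'v \<Rightarrow> real" where
  "total_conductance c x = (\<Sum>\<^sub>\<infinity>y. c x y)"

definition network_step :: "('v \<Rightarrow> 'v \<Rightarrow> real) \<Rightarrow> 'v \<Rightarrow> 'v pmf" where
  "network_step c x = embed_pmf (\<lambda>y. c x y / total_conductance c x)"

definition effective_conductance :: "('v \<Rightarrow> 'v \<Rightarrow> real) \<Rightarrow> 'v \<Rightarrow> real" where
  "effective_conductance c a =
     total_conductance c a * measure (markov_chain (network_step c) a) {X. \<forall>n>0. X n \<noteq> a}"

definition tree_conductance :: "real \<Rightarrow> tree \<Rightarrow> vertex \<Rightarrow> vertex \<Rightarrow> real" where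
  "tree_conductance l T x y =
     (if x \<in> T \<and> y \<in> T \<and> (\<exists>i. y = x @ [i] \<or> x = y @ [i])
      then (1 / l) ^ min (length x) (length y) else 0)"

lemma network_step_tree_conductance:
  assumes "T \<in> trees" "x \<in> T" "l > 0"
  shows "network_step (tree_conductance l T) x = biased_step l T x"
proof -
  let ?c = "tree_conductance l T x"
  let ?n = "real (nu T x)"
  note fin = finite_children[OF assms(1,2)]
  have n: "?n > 0"
    using fin children_nonempty[OF assms(1,2)] by (simp add: nu_def card_gt_0_iff)
  have child: "?c y = (1 / l) ^ length x" if "y \<in> children T x" for y
    using that assms by (auto simp: tree_conductance_def children_def)
  have "?c y = 0" if "y \<notin> children T x" "x = []" for y
    using that by (auto simp: tree_conductance_def children_def)
  moreover have "?c y = 0" if "y \<notin> children T x" "y \<noteq> butlast x" for y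
    using that by (auto simp: tree_conductance_def children_def)
  ultimately have zero: "?c y = 0" if "y \<notin> children T x" "x = [] \<or> y \<noteq> butlast x" for y
    using that by blast
  show ?thesis
  proof (cases "x = []")
    case True
    have "total_conductance (tree_conductance l T) x = (\<Sum>\<^sub>\<infinity>y\<in>children T x. ?c y)"
      unfolding total_conductance_def
      by (intro infsum_cong_neutral) (use zero True in auto)
    also have "\<dots> = ?n"
      using fin child True by (simp add: nu_def)
    finally have "(\<lambda>y. ?c y / total_conductance (tree_conductance l T) x) = pmf (pmf_of_set (children T x))"
      using zero child True fin n by (auto simp: fun_eq_iff indicator_def nu_def card_gt_0_iff)
    then show ?thesis
      using True type_definition.Rep_inverse[OF td_pmf_embed_pmf]
      by (simp add: network_step_def biased_step_def)
  next
    case False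
    then obtain w i where x: "x = w @ [i]" by (metis rev_exhaust)
    have "w \<in> T" using assms(1,2) x by (auto simp: trees_def)
    then have parent: "?c w = (1 / l) ^ length w"
      using assms(2) x by (auto simp: tree_conductance_def)
    have nin: "w \<notin> children T x" using x by (auto simp: children_def)
    have "total_conductance (tree_conductance l T) x = (\<Sum>\<^sub>\<infinity>y\<in>insert w (children T x). ?c y)"
      unfolding total_conductance_def
      by (intro infsum_cong_neutral) (use zero x in auto)
    also have "\<dots> = (1 / l) ^ length w + ?n * (1 / l) ^ length x"
      using fin nin child parent by (simp add: nu_def)
    also have "\<dots> = (?n + l) * (1 / l) ^ length x"
      using assms(3) x by (simp add: field_simps)
    finally have total: "total_conductance (tree_conductance l T) x = (?n + l) * (1 / l) ^ length x" .
    have ratio: "(1 / l) ^ length w = l * (1 / l) ^ length x"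
      using assms(3) x by simp
    have "?c y / total_conductance (tree_conductance l T) x =
            (if y = butlast x then l / (?n + l)
             else if y \<in> children T x then 1 / (?n + l) else 0)" for y
    proof -
      define P where "P = (1 / l) ^ length x"
      have "P \<noteq> 0" using assms(3) by (simp add: P_def)
      moreover have "butlast x = w" using x by simp
      moreover have "?c w = l * P" using parent ratio by (simp only: P_def)
      moreover have "?c y = P" if "y \<in> children T x" using child[OF that] by (simp only: P_def)
      moreover have "?c y = 0" if "y \<notin> children T x" "y \<noteq> w"
        using zero[of y] that \<open>butlast x = w\<close> by simp
      ultimately show ?thesis
        unfolding total P_def[symmetric] by (cases "y = w"; cases "y \<in> children T x") simp_all
    qed
    then show ?thesis
      using False by (simp add: network_step_def biased_step_def)
  qed
qed

definition conductance :: "real \<Rightarrow> tree \<Rightarrow> real" where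
  "conductance l T = effective_conductance (tree_conductance l T) []"

section \<open>The augmented Galton--Watson measure\<close>

text \<open>
  In \<open>join T T'\<close> the root of \<open>T'\<close> is \<open>[]\<close>, and the root of \<open>T\<close> becomes its first child
  \<open>[0]\<close>. A ray of \<open>T\<close> becomes a ray of \<open>join T T'\<close> issued from the root, via \<open>[0]\<close>.
\<close>

definition join :: "tree \<Rightarrow> tree \<Rightarrow> tree" where
  "join T T' = insert [] ((#) 0 ` T \<union> {Suc i # u | i u. i # u \<in> T'})"

definition join_ray :: "ray \<Rightarrow> ray" where
  "join_ray R n = (case n of 0 \<Rightarrow> [] | Suc k \<Rightarrow> 0 # R k)"

text \<open>The law of \<open>(T, T', R)\<close> with \<open>T, T'\<close> independent and \<open>R\<close> harmonic on \<open>T\<close>.\<close>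

definition coupling :: "nat pmf \<Rightarrow> real \<Rightarrow> (tree \<times> tree \<times> ray) measure" where
  "coupling p l =
     do {
       T \<leftarrow> GW p;
       T' \<leftarrow> GW p;
       R \<leftarrow> harmonic_measure l T;
       return (tree_space \<Otimes>\<^sub>M tree_space \<Otimes>\<^sub>M ray_space) (T, T', R)
     }"

definition agw_weight :: "real \<Rightarrow> tree \<Rightarrow> tree \<Rightarrow> real" where
  "agw_weight l T T' =
     (l + real (nu T' [])) * beta l T / (l - 1 + beta l T + conductance l T')"

definition agw_const :: "nat pmf \<Rightarrow> real \<Rightarrow> real" where
  "agw_const p l = (\<integral>(T, T'). agw_weight l T T' \<partial>(GW p \<Otimes>\<^sub>M GW p))"

text \<open>
  As \<open>(T, T', R)\<close> is determined by \<open>(join T T', join_ray R)\<close>, weighting the law of the former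
  and then mapping it is the same as taking the density with respect to the law of the latter.
\<close>

definition AGW :: "nat pmf \<Rightarrow> real \<Rightarrow> (tree \<times> ray) measure" where
  "AGW p l =
     distr (density (coupling p l) (\<lambda>(T, T', R). ennreal (agw_weight l T T' / agw_const p l)))
       (tree_space \<Otimes>\<^sub>M ray_space) (\<lambda>(T, T', R). (join T T', join_ray R))"

definition nu_plus :: "tree \<Rightarrow> real" where
  "nu_plus T = real (nu T []) - 1"

end

theory Submission
  imports Defs
begin

text \<open>
  As \<open>l\<close> tends to \<open>0\<close>, the walk is hardly ever pulled back, and the density that defines
  \<open>AGW p l\<close> tends to \<open>1\<close>. The reweighting disappears in the limit, and what
  remains is the mean offspring number \<open>m\<close> of the root of a plain Galton--Watson tree.

  The convergence of the density is uniform. For \<open>0 < l < 1\<close>, the function \<open>x \<mapsto> l ^ length x\<close> is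
  superharmonic for the biased walk off the root of any leafless tree, so from level \<open>1\<close> the root
  is hit with probability at most \<open>l\<close>. Consequently \<open>1 - l \<le> beta l T \<le> 1\<close>
  and \<open>(1 - l) * nu T [] \<le> conductance l T \<le> nu T []\<close> for every tree (\<open>beta_ge\<close>,
  \<open>conductance_ge\<close>). Inserted in the formula for the weight, this shows that the weight lies
  between \<open>1 - l\<close> and \<open>(1 + l) / (1 - l)\<close> (\<open>agw_weight_bounds\<close>). So does its mean, the
  normalising constant, and the integral of \<open>nu_plus\<close> is between \<open>(1 - l)\<^sup>2 / (1 + l) * m\<close> and
  \<open>(1 + l) / (1 - l)\<^sup>2 * m\<close> (\<open>integral_nu_plus_AGW_bounds\<close>). Both bounds tend to \<open>m\<close>.

  These estimates bear on the integrals only once all objects are known to depend measurably on the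
  tree: the integral of a non-measurable function and the bind with a non-measurable kernel
  have conventional values. This is why a large part of the development shows that the law of a
  Markov chain is a measurable function of its kernel (\<open>measurable_markov_chain\<close>) and derives from
  it that \<open>beta\<close>, \<open>conductance\<close> and \<open>harmonic_measure\<close> are measurable.
\<close>

section \<open>Finite segments of a Markov chain\<close>

text \<open>
  The law of the first \<open>n + 1\<close> states as a discrete distribution on lists. Questions about
  finitely many steps of the chain become questions about this recursion, in which the first
  step is split off; that is the form in which the Markov property is used below.
\<close>

primrec path_pmf :: "('s \<Rightarrow> 's pmf) \<Rightarrow> nat \<Rightarrow> 's \<Rightarrow> 's list pmf" where
  "path_pmf K 0 x = return_pmf [x]"
| "path_pmf K (Suc n) x = bind_pmf (K x) (\<lambda>y. map_pmf ((#) x) (path_pmf K n y))"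

lemma set_path_pmf: "xs \<in> set_pmf (path_pmf K n x) \<Longrightarrow> length xs = Suc n \<and> hd xs = x"
proof (induction n arbitrary: x xs)
  case (Suc n)
  then obtain y ys where "ys \<in> set_pmf (path_pmf K n y)" "xs = x # ys" by auto
  with Suc.IH[of ys y] show ?case by simp
qed simp

lemma pmf_path_pmf:
  assumes "length xs = Suc n" "hd xs = x"
  shows "pmf (path_pmf K n x) xs = (\<Prod>i<n. pmf (K (xs ! i)) (xs ! Suc i))"
  using assms
proof (induction n arbitrary: x xs)
  case 0
  then show ?case by (cases xs) auto
next
  case (Suc n)
  then obtain ys where xs: "xs = x # ys" and len: "length ys = Suc n" by (cases xs) auto
  let ?P = "\<Prod>i<n. pmf (K (ys ! i)) (ys ! Suc i)"
  have "pmf (map_pmf ((#) x) (path_pmf K n y)) xs = ?P * indicator {hd ys} y" for y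
  proof -
    have "pmf (map_pmf ((#) x) (path_pmf K n y)) xs = pmf (path_pmf K n y) ys"
      unfolding xs by (rule pmf_map_inj') simp
    also have "\<dots> = ?P * indicator {hd ys} y"
      using Suc.IH[OF len, of y] set_path_pmf[of ys K n y]
      by (cases "hd ys = y") (auto simp: pmf_eq_0_set_pmf)
    finally show ?thesis .
  qed
  then have "pmf (path_pmf K (Suc n) x) xs = ?P * pmf (K x) (hd ys)"
    by (simp add: pmf_bind measure_pmf_single)
  also have "\<dots> = (\<Prod>i<Suc n. pmf (K (xs ! i)) (xs ! Suc i))"
    using len by (cases ys) (simp_all add: xs prod.lessThan_Suc_shift mult.commute del: prod.lessThan_Suc)
  finally show ?case .
qed

lemma sets_markov_chain [simp, measurable_cong]:
  "sets (markov_chain K x) = sets (\<Pi>\<^sub>M n\<in>UNIV. count_space UNIV)"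
  and space_markov_chain [simp]: "space (markov_chain K x) = UNIV"
  by (simp_all add: markov_chain_def space_PiM PiE_UNIV_domain)

lemma prob_space_markov_chain:
  fixes K :: "'s::countable \<Rightarrow> 's pmf"
  shows "prob_space (markov_chain K x)"
  unfolding markov_chain_def
  by (intro prob_space.prob_space_distr measurable_trajectory prob_space_PiM)
     (auto simp: prob_space_measure_pmf split: prod.split)

definition cylinder :: "'s list \<Rightarrow> (nat \<Rightarrow> 's) set" where
  "cylinder xs = {X. map X [0..<length xs] = xs}"

lemma cylinder_iff: "X \<in> cylinder xs \<longleftrightarrow> (\<forall>i<length xs. X i = xs ! i)"
  unfolding cylinder_def mem_Collect_eq list_eq_iff_nth_eq by simp

lemma measurable_prefix [measurable]:
  "(\<lambda>X. map X [0..<n]) \<in> measurable (\<Pi>\<^sub>M n\<in>UNIV. count_space (UNIV :: 's::countable set)) (count_space UNIV)"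
proof -
  have "{X. map X [0..<n] = xs} \<in> sets (\<Pi>\<^sub>M n\<in>UNIV. count_space (UNIV :: 's set))" for xs
  proof (cases "length xs = n")
    case True
    have "{X \<in> space (\<Pi>\<^sub>M n\<in>UNIV. count_space (UNIV :: 's set)). \<forall>i\<in>{..<n}. X i = xs ! i}
        \<in> sets (\<Pi>\<^sub>M n\<in>UNIV. count_space (UNIV :: 's set))"
      by measurable
    also have "{X \<in> space (\<Pi>\<^sub>M n\<in>UNIV. count_space (UNIV :: 's set)). \<forall>i\<in>{..<n}. X i = xs ! i} =
        {X. map X [0..<n] = xs}"
      using True by (auto simp: space_PiM PiE_UNIV_domain list_eq_iff_nth_eq)
    finally show ?thesis .
  next
    case False
    then have "{X. map X [0..<n] = xs} = {}" by auto
    then show ?thesis by simp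
  qed
  then show ?thesis
    by (subst measurable_count_space_eq2_countable)
       (auto simp: vimage_def space_PiM PiE_UNIV_domain)
qed

text \<open>
  Both laws live on a countable set and have the same point masses, which are the products of
  transition probabilities along the path. A list of the wrong length or with the wrong first
  state has mass \<open>0\<close> on either side, because the chain starts at \<open>x\<close> almost surely.
\<close>

lemma distr_prefix_markov_chain:
  fixes K :: "'s::countable \<Rightarrow> 's pmf"
  shows "distr (markov_chain K x) (count_space UNIV) (\<lambda>X. map X [0..<Suc n]) = measure_pmf (path_pmf K n x)"
proof (rule measure_eqI_countable[of _ UNIV])
  fix xs :: "'s list"
  interpret M: prob_space "markov_chain K x" by (rule prob_space_markov_chain)
  let ?A = "{X. map X [0..<Suc n] = xs}"
  have pre: "(\<lambda>X. map X [0..<Suc n]) -` {xs} \<inter> space (markov_chain K x) = ?A"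
    by auto
  have meas: "(\<lambda>X. map X [0..<Suc n]) \<in> measurable (markov_chain K x) (count_space UNIV)"
    by measurable
  have x0: "AE X in markov_chain K x. X 0 = x"
  proof -
    have "M.prob {X. \<forall>i\<le>0. X i = x} = 1"
      using markov_chain_cylinder[of "\<lambda>_. x" x K 0] by simp
    moreover have "{X \<in> space (\<Pi>\<^sub>M n\<in>UNIV. count_space (UNIV :: 's set)). X 0 = x}
        \<in> sets (\<Pi>\<^sub>M n\<in>UNIV. count_space (UNIV :: 's set))"
      by measurable
    ultimately show ?thesis by (subst (asm) M.prob_eq_1) (auto simp: space_PiM PiE_UNIV_domain)
  qed
  have "measure (markov_chain K x) ?A = pmf (path_pmf K n x) xs"
  proof (cases "length xs = Suc n \<and> hd xs = x")
    case True
    then have "xs ! 0 = x" by (cases xs) auto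
    moreover have "?A = {X. \<forall>i\<le>n. X i = xs ! i}"
      using True by (auto simp: list_eq_iff_nth_eq less_Suc_eq_le simp del: upt_Suc)
    ultimately show ?thesis
      using markov_chain_cylinder[of "(!) xs" x K n] pmf_path_pmf[of xs n x K] True by simp
  next
    case False
    then have "pmf (path_pmf K n x) xs = 0"
      using set_path_pmf[of xs K n x] by (auto simp: pmf_eq_0_set_pmf)
    moreover have "AE X in markov_chain K x. X \<notin> ?A"
      using x0
    proof eventually_elim
      case (elim X)
      then have "hd (map X [0..<Suc n]) = x" by (simp add: upt_conv_Cons del: upt_Suc)
      then show ?case using False by force
    qed
    then have "measure (markov_chain K x) ?A = 0"
      by (subst M.prob_eq_0) (use measurable_sets[OF meas, of "{xs}"] pre in auto)
    ultimately show ?thesis by simp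
  qed
  then show "emeasure (distr (markov_chain K x) (count_space UNIV) (\<lambda>X. map X [0..<Suc n])) {xs} =
      emeasure (measure_pmf (path_pmf K n x)) {xs}"
    by (subst emeasure_distr) (use meas pre in \<open>auto simp: M.emeasure_eq_measure emeasure_pmf_single\<close>)
qed auto

section \<open>Measurable dependence on the transition kernel\<close>

text \<open>
  The state space is countable, so an event that concerns one coordinate is a countable union of
  cylinders over the initial segments that realise it.
\<close>

lemma sets_sequence_cylinders:
  "sets (\<Pi>\<^sub>M n\<in>UNIV. count_space (UNIV :: 's::countable set)) = sigma_sets UNIV (insert {} (range cylinder))"
proof
  have "{X. X i \<in> A} \<in> sigma_sets UNIV (insert {} (range cylinder))" for i and A :: "'s set"
  proof -
    have "{X. X i \<in> A} = (\<Union>xs\<in>{xs. length xs = Suc i \<and> xs ! i \<in> A}. cylinder xs)"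
    proof safe
      fix X :: "nat \<Rightarrow> 's" assume "X i \<in> A"
      then show "X \<in> (\<Union>xs\<in>{xs. length xs = Suc i \<and> xs ! i \<in> A}. cylinder xs)"
        by (intro UN_I[of "map X [0..<Suc i]"]) (auto simp: cylinder_def nth_append)
    qed (auto simp: cylinder_iff)
    then show ?thesis
      by (simp only:) (intro sigma_sets_UNION countableI_type, auto)
  qed
  then show "sets (\<Pi>\<^sub>M n\<in>UNIV. count_space UNIV) \<subseteq> sigma_sets UNIV (insert {} (range (cylinder :: 's list \<Rightarrow> _)))"
    unfolding sets_PiM_single by (simp add: PiE_UNIV_domain) (rule sigma_sets_mono, auto)
  have "cylinder xs \<in> sets (\<Pi>\<^sub>M n\<in>UNIV. count_space UNIV)" for xs :: "'s list"
    using measurable_sets[OF measurable_prefix[of "length xs"], of "{xs}"]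
    by (simp add: cylinder_def vimage_def space_PiM PiE_UNIV_domain)
  then show "sigma_sets UNIV (insert {} (range (cylinder :: 's list \<Rightarrow> _))) \<subseteq> sets (\<Pi>\<^sub>M n\<in>UNIV. count_space UNIV)"
    using sets.sigma_sets_subset[of "insert {} (range cylinder)" "\<Pi>\<^sub>M n\<in>UNIV. count_space (UNIV::'s set)"]
    by (auto simp: space_PiM PiE_UNIV_domain)
qed

text \<open>
  Of two cylinders, either the one over the longer word is contained in the other or they are
  disjoint. Hence the cylinders form a generator on which measurability of a kernel may be tested.
\<close>

lemma Int_stable_cylinders: "Int_stable (insert {} (range cylinder))"
proof (rule Int_stableI)
  have *: "cylinder xs \<inter> cylinder ys \<in> insert {} (range cylinder)" if "length xs \<le> length ys" for xs ys :: "'a list"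
  proof (cases "take (length xs) ys = xs")
    case True
    then have "cylinder xs \<inter> cylinder ys = cylinder ys"
      using that by (auto simp: cylinder_iff) (metis nth_take order_less_le_trans)
    then show ?thesis by auto
  next
    case False
    have "cylinder xs \<inter> cylinder ys = {}"
    proof (rule ccontr)
      assume "\<not> ?thesis"
      then obtain X where "X \<in> cylinder xs" "X \<in> cylinder ys" by auto
      then have "take (length xs) ys = xs"
        using that by (auto simp: list_eq_iff_nth_eq cylinder_iff)
      with False show False by simp
    qed
    then show ?thesis by auto
  qed
  fix A B :: "(nat \<Rightarrow> 'a) set"
  assume "A \<in> insert {} (range cylinder)" "B \<in> insert {} (range cylinder)"
  then consider "A = {} \<or> B = {}" | xs ys where "A = cylinder xs" "B = cylinder ys" by auto
  then show "A \<inter> B \<in> insert {} (range cylinder)"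
  proof cases
    case 2
    then show ?thesis
      using *[of xs ys] *[of ys xs] by (cases "length xs \<le> length ys") (auto simp: Int_commute)
  qed auto
qed

text \<open>
  The probability of a cylinder is a finite product of transition probabilities, so it depends
  measurably on a parameter of the kernel; the cylinders determine everything else.
\<close>

lemma measurable_markov_chain:
  fixes K :: "'a \<Rightarrow> 's::countable \<Rightarrow> 's pmf"
  assumes [measurable]: "\<And>x y. (\<lambda>a. pmf (K a x) y) \<in> borel_measurable M"
  shows "(\<lambda>a. markov_chain (K a) x) \<in> measurable M (prob_algebra (\<Pi>\<^sub>M n\<in>UNIV. count_space UNIV))"
proof (rule measurable_prob_algebra_generated[OF sets_sequence_cylinders Int_stable_cylinders])
  fix A :: "(nat \<Rightarrow> 's) set"
  assume "A \<in> insert {} (range cylinder)"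
  then consider "A = {}" | "A = UNIV" | xs where "A = cylinder xs" "xs \<noteq> []"
    by (auto simp: cylinder_def)
  then show "(\<lambda>a. emeasure (markov_chain (K a) x) A) \<in> borel_measurable M"
  proof cases
    case 2
    then show ?thesis
      by (simp add: prob_space.emeasure_space_1[OF prob_space_markov_chain, simplified])
  next
    case 3
    then obtain n where n: "length xs = Suc n" by (cases xs) auto
    have "emeasure (markov_chain (K a) x) A = ennreal (pmf (path_pmf (K a) n x) xs)" for a
    proof -
      have "A = (\<lambda>X. map X [0..<Suc n]) -` {xs} \<inter> space (markov_chain (K a) x)"
        using 3 n by (auto simp: cylinder_def)
      then have "emeasure (markov_chain (K a) x) A =
          emeasure (distr (markov_chain (K a) x) (count_space UNIV) (\<lambda>X. map X [0..<Suc n])) {xs}"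
        by (subst emeasure_distr) auto
      then show ?thesis by (simp only: distr_prefix_markov_chain emeasure_pmf_single)
    qed
    moreover have "pmf (path_pmf (K a) n x) xs =
        (if hd xs = x then \<Prod>i<n. pmf (K a (xs ! i)) (xs ! Suc i) else 0)" for a
      using pmf_path_pmf[OF n] set_path_pmf[of xs "K a" n x] by (auto simp: pmf_eq_0_set_pmf)
    ultimately show ?thesis by simp
  qed simp
qed (auto intro: prob_space_markov_chain)

lemma measurable_last_visit [measurable]:
  "(\<lambda>X. last_visit X v) \<in> measurable (\<Pi>\<^sub>M n\<in>UNIV. count_space (UNIV :: 's::countable set)) (count_space UNIV)"
  unfolding last_visit_def by measurable

text \<open>
  The maximum of a random set of times is measurable whether or not the set is finite, since
  \<open>Max\<close> takes one fixed value on all infinite sets. So loop erasure is measurable on all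
  trajectories, recurrent ones included.
\<close>

lemma measurable_loop_erasure:
  "loop_erasure \<in> measurable (\<Pi>\<^sub>M n\<in>UNIV. count_space (UNIV :: 's::countable set)) (\<Pi>\<^sub>M n\<in>UNIV. count_space UNIV)"
proof -
  let ?M = "\<Pi>\<^sub>M n\<in>UNIV. count_space (UNIV :: 's set)"
  have at_time: "(\<lambda>X. X (t X)) \<in> measurable ?M (count_space UNIV)"
    if "t \<in> measurable ?M (count_space UNIV)" for t :: "(nat \<Rightarrow> 's) \<Rightarrow> nat"
    by (rule measurable_compose_countable[OF _ that]) measurable
  have last: "(\<lambda>X. last_visit X (X (t X))) \<in> measurable ?M (count_space UNIV)"
    if "t \<in> measurable ?M (count_space UNIV)" for t :: "(nat \<Rightarrow> 's) \<Rightarrow> nat"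
    by (rule measurable_compose_countable[OF _ at_time[OF that]]) measurable
  have "(\<lambda>X. loop_erasure_time X k) \<in> measurable ?M (count_space UNIV)" for k
  proof (induction k)
    case 0
    show ?case using last[of "\<lambda>_. 0"] by simp
  next
    case (Suc k)
    show ?case
      unfolding loop_erasure_time.simps by (rule last) (intro measurable_compose[OF Suc], simp)
  qed
  from at_time[OF this] have "(\<lambda>X. loop_erasure X k) \<in> measurable ?M (count_space UNIV)" for k
    unfolding loop_erasure_def .
  then show ?thesis
    by (intro measurable_PiM_single') (auto simp: PiE_UNIV_domain)
qed

section \<open>Hitting probabilities and superharmonic functions\<close>

text \<open>
  Passage from finite to infinite horizon: an event that persists once it has occurred has a
  probability bounded by the bound for its finite-time versions, by continuity from below.
\<close>

lemma path_pmf_event_bound: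
  fixes K :: "'s::countable \<Rightarrow> 's pmf"
  assumes "\<And>xs y. P xs \<Longrightarrow> P (xs @ [y])"
    and bound: "\<And>n. emeasure (path_pmf K n x) {xs. P xs} \<le> c"
  shows "emeasure (markov_chain K x) {X. \<exists>n. P (map X [0..<Suc n])} \<le> c"
proof -
  let ?M = "markov_chain K x" and ?A = "\<lambda>n. {X. P (map X [0..<Suc n])}"
  have [measurable]: "(\<lambda>X. map X [0..<Suc n]) \<in> measurable ?M (count_space UNIV)" for n
    by measurable
  have A: "?A n = (\<lambda>X. map X [0..<Suc n]) -` {xs. P xs} \<inter> space ?M" for n
    by auto
  have "{X. \<exists>n. P (map X [0..<Suc n])} = (\<Union>n. ?A n)" by auto
  also have "emeasure ?M \<dots> = (SUP n. emeasure ?M (?A n))"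
  proof (rule SUP_emeasure_incseq[symmetric])
    show "range ?A \<subseteq> sets ?M"
      unfolding A by (intro image_subsetI measurable_sets[of _ _ "count_space UNIV"]) auto
    show "incseq ?A"
    proof (intro incseq_SucI subsetI CollectI)
      fix n X assume "X \<in> ?A n"
      then show "P (map X [0..<Suc (Suc n)])"
        using assms(1)[of "map X [0..<Suc n]" "X (Suc n)"] by simp
    qed
  qed
  also have "\<dots> \<le> c"
  proof (rule SUP_least)
    fix n
    have "emeasure ?M (?A n) = emeasure (distr ?M (count_space UNIV) (\<lambda>X. map X [0..<Suc n])) {xs. P xs}"
      unfolding A by (rule emeasure_distr[symmetric]) auto
    then show "emeasure ?M (?A n) \<le> c"
      using bound[of n] by (simp only: distr_prefix_markov_chain)
  qed
  finally show ?thesis .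
qed

text \<open>
  The maximum principle: a nonnegative function that is superharmonic off \<open>z\<close> and at least \<open>1\<close>
  at \<open>z\<close> dominates the probability of hitting \<open>z\<close>. The induction splits off the first step and
  averages the induction hypothesis. The set \<open>S\<close> confines the chain to the states where \<open>h\<close> is
  known to be superharmonic.
\<close>

lemma path_pmf_hitting_le:
  fixes h :: "'s \<Rightarrow> ennreal"
  assumes "x \<in> S" and "h z \<ge> 1"
    and closed: "\<And>x. x \<in> S \<Longrightarrow> x \<noteq> z \<Longrightarrow> set_pmf (K x) \<subseteq> S"
    and super: "\<And>x. x \<in> S \<Longrightarrow> x \<noteq> z \<Longrightarrow> (\<integral>\<^sup>+y. h y \<partial>K x) \<le> h x"
  shows "emeasure (path_pmf K n x) {xs. z \<in> set xs} \<le> h x"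
  using assms(1)
proof (induction n arbitrary: x)
  case 0
  then show ?case using assms(2) by (auto simp: indicator_def)
next
  case (Suc n)
  show ?case
  proof (cases "x = z")
    case True
    then show ?thesis
      using order_trans[OF measure_pmf.emeasure_le_1 assms(2)] by blast
  next
    case False
    have "emeasure (path_pmf K (Suc n) x) {xs. z \<in> set xs}
        = (\<integral>\<^sup>+y. emeasure (path_pmf K n y) {xs. z \<in> set xs} \<partial>K x)"
      using False by (simp add: vimage_def)
    also have "\<dots> \<le> (\<integral>\<^sup>+y. h y \<partial>K x)"
      using closed[OF Suc.prems False] Suc.IH
      by (intro nn_integral_mono_AE) (auto simp: AE_measure_pmf_iff)
    also have "\<dots> \<le> h x" using super Suc.prems False by blast
    finally show ?thesis .
  qed
qed

lemma markov_chain_hitting_le: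
  fixes K :: "'s::countable \<Rightarrow> 's pmf" and h :: "'s \<Rightarrow> ennreal"
  assumes "x \<in> S" and "h z \<ge> 1"
    and "\<And>x. x \<in> S \<Longrightarrow> x \<noteq> z \<Longrightarrow> set_pmf (K x) \<subseteq> S"
    and "\<And>x. x \<in> S \<Longrightarrow> x \<noteq> z \<Longrightarrow> (\<integral>\<^sup>+y. h y \<partial>K x) \<le> h x"
  shows "emeasure (markov_chain K x) {X. \<exists>n. X n = z} \<le> h x"
proof -
  have "{X. \<exists>n. X n = z} = {X. \<exists>n. z \<in> set (map X [0..<Suc n])}" by force
  then show ?thesis
    using path_pmf_event_bound[of "\<lambda>xs. z \<in> set xs" K x "h x"] path_pmf_hitting_le[OF assms]
    by simp
qed

text \<open>
  After the first step, a return is a hit from one of the possible first positions.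
\<close>

lemma markov_chain_return_le:
  fixes K :: "'s::countable \<Rightarrow> 's pmf" and h :: "'s \<Rightarrow> ennreal"
  assumes "\<And>y. y \<in> set_pmf (K x) \<Longrightarrow> y \<in> S \<and> h y \<le> c" and "h z \<ge> 1"
    and "\<And>x. x \<in> S \<Longrightarrow> x \<noteq> z \<Longrightarrow> set_pmf (K x) \<subseteq> S"
    and "\<And>x. x \<in> S \<Longrightarrow> x \<noteq> z \<Longrightarrow> (\<integral>\<^sup>+y. h y \<partial>K x) \<le> h x"
  shows "emeasure (markov_chain K x) {X. \<exists>n>0. X n = z} \<le> c"
proof -
  have bound: "emeasure (path_pmf K n x) {xs. xs \<noteq> [] \<and> z \<in> set (tl xs)} \<le> c" for n
  proof (cases n)
    case (Suc k)
    have "emeasure (path_pmf K n x) {xs. xs \<noteq> [] \<and> z \<in> set (tl xs)}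
        = (\<integral>\<^sup>+y. emeasure (path_pmf K k y) {xs. z \<in> set xs} \<partial>K x)"
      by (simp add: Suc vimage_def)
    also have "\<dots> \<le> (\<integral>\<^sup>+y. c \<partial>K x)"
    proof (intro nn_integral_mono_AE, unfold AE_measure_pmf_iff, intro ballI)
      fix y assume "y \<in> set_pmf (K x)"
      then show "emeasure (path_pmf K k y) {xs. z \<in> set xs} \<le> c"
        using assms(1) path_pmf_hitting_le[OF _ assms(2-4), of y k] order_trans by blast
    qed
    also have "\<dots> = c" by simp
    finally show ?thesis .
  qed simp
  have tl: "set (tl (map X [0..<Suc n])) = X ` {1..<Suc n}" for X :: "nat \<Rightarrow> 's" and n
    by (simp add: upt_conv_Cons del: upt_Suc)
  have "(\<exists>n>0. X n = z) \<longleftrightarrow> (\<exists>n. z \<in> X ` {1..<Suc n})" for X :: "nat \<Rightarrow> 's"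
  proof
    assume "\<exists>n>0. X n = z"
    then obtain n where "n > 0" "X n = z" by blast
    then have "z \<in> X ` {1..<Suc n}" by (intro image_eqI[of _ _ n]) auto
    then show "\<exists>n. z \<in> X ` {1..<Suc n}" ..
  qed (auto simp: Suc_le_eq)
  then have "{X. \<exists>n>0. X n = z} = {X. \<exists>n. map X [0..<Suc n] \<noteq> [] \<and> z \<in> set (tl (map X [0..<Suc n]))}"
    unfolding tl by simp
  then show ?thesis
    using path_pmf_event_bound[of "\<lambda>xs. xs \<noteq> [] \<and> z \<in> set (tl xs)" K x c] bound by simp
qed

section \<open>Escape of the biased walk\<close>

lemma children_eq_image: "children T u = (\<lambda>i. u @ [i]) ` {i. u @ [i] \<in> T}"
  by (auto simp: children_def)

text \<open>
  The offspring number of a vertex can be read off from which words belong to the tree. This also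
  covers words outside the tree, whose offspring number is \<open>0\<close>.
\<close>

lemma child_in_tree_iff:
  assumes "T \<in> trees"
  shows "u @ [i] \<in> T \<longleftrightarrow> i < nu T u"
proof (cases "u \<in> T")
  case True
  then obtain k where k: "{i. u @ [i] \<in> T} = {..<k}" using assms by (auto simp: trees_def)
  have "nu T u = k"
    unfolding nu_def children_eq_image k by (subst card_image) (auto simp: inj_on_def)
  then show ?thesis using k by blast
next
  case False
  then have "\<not> u @ [i] \<in> T" for i using assms by (auto simp: trees_def)
  then show ?thesis by (simp add: nu_def children_eq_image)
qed

lemma nu_pos: "T \<in> trees \<Longrightarrow> u \<in> T \<Longrightarrow> 0 < nu T u"
  using finite_children[of T u] children_nonempty[of T u] by (simp add: nu_def card_gt_0_iff)

lemma star_tree_in_trees: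
  assumes "T \<in> trees"
  shows "star_tree T \<in> trees"
proof -
  have mem: "u \<in> star_tree T \<longleftrightarrow> (case u of [] \<Rightarrow> True | i # v \<Rightarrow> i = 0 \<and> v \<in> T)" for u
    by (auto simp: star_tree_def split: list.split)
  have T: "[] \<in> T" "\<And>u i. u @ [i] \<in> T \<Longrightarrow> u \<in> T"
    "\<And>u. u \<in> T \<Longrightarrow> \<exists>k>0. {i. u @ [i] \<in> T} = {..<k}"
    using assms by (auto simp: trees_def)
  show ?thesis
    unfolding trees_def
  proof (intro CollectI conjI allI impI ballI)
    fix u i assume "u @ [i] \<in> star_tree T"
    then show "u \<in> star_tree T" using T(2) by (cases u) (auto simp: mem)
  next
    fix u assume u: "u \<in> star_tree T"
    show "\<exists>k>0. {i. u @ [i] \<in> star_tree T} = {..<k}"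
    proof (cases u)
      case Nil
      then show ?thesis using T(1) by (intro exI[of _ 1]) (auto simp: mem)
    next
      case (Cons j v)
      then show ?thesis using T(3)[of v] u by (simp add: mem)
    qed
  qed (simp add: mem)
qed

lemma set_pmf_biased_step_root:
  assumes "T \<in> trees"
  shows "set_pmf (biased_step l T []) = children T []"
  using assms finite_children[OF assms] children_nonempty[OF assms]
  by (simp add: biased_step_def trees_def)

lemma set_pmf_biased_step_subset:
  assumes "T \<in> trees" "x \<in> T" "x \<noteq> []" "l > 0"
  shows "set_pmf (biased_step l T x) \<subseteq> insert (butlast x) (children T x)"
  using pmf_biased_step[OF assms] by (auto simp: set_pmf_iff split: if_splits)

lemma set_pmf_biased_step:
  assumes "T \<in> trees" "x \<in> T" "l > 0"
  shows "set_pmf (biased_step l T x) \<subseteq> T"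
proof (cases "x = []")
  case True
  then show ?thesis using set_pmf_biased_step_root[OF assms(1)] by (auto simp: children_def)
next
  case False
  then have "butlast x @ [last x] \<in> T" using assms by simp
  then have "butlast x \<in> T" using assms(1) unfolding trees_def by blast
  then show ?thesis
    using set_pmf_biased_step_subset[OF assms(1,2) False assms(3)] by (auto simp: children_def)
qed

text \<open>
  With at least one child at every vertex, the walk is at least as strongly pulled away from the
  root as the walk on a half-line that steps back with probability \<open>l / (1 + l)\<close>. For that
  walk the probability of ever descending \<open>k\<close> levels is \<open>l ^ k\<close>, which is the origin of the
  function used here. For a vertex with \<open>n\<close> children the inequality amounts to
  \<open>(1 - l) * (n - 1) \<ge> 0\<close>.
\<close>

lemma biased_step_superharmonic:
  assumes "T \<in> trees" "x \<in> T" "x \<noteq> []" "0 < l" "l < 1"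
  shows "(\<integral>\<^sup>+y. ennreal (l ^ length y) \<partial>biased_step l T x) \<le> ennreal (l ^ length x)"
proof -
  let ?n = "real (nu T x)" and ?C = "children T x"
  note fin = finite_children[OF assms(1,2)]
  note pmf = pmf_biased_step[OF assms(1-4)]
  obtain k where k: "length x = Suc k" using assms(3) by (cases x) auto
  have nin: "butlast x \<notin> ?C"
  proof
    assume "butlast x \<in> ?C"
    then obtain i where "butlast x = x @ [i]" by (auto simp: children_def)
    then have "length (butlast x) = Suc (length x)" by simp
    then show False by simp
  qed
  have n: "?n \<ge> 1" using nu_pos[OF assms(1,2)] by simp
  have "(\<integral>\<^sup>+y. ennreal (l ^ length y) \<partial>biased_step l T x)
      = (\<Sum>y\<in>insert (butlast x) ?C. ennreal (l ^ length y) * pmf (biased_step l T x) y)"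
    using fin set_pmf_biased_step_subset[OF assms(1-4)]
    by (intro nn_integral_measure_pmf_support) (auto simp: set_pmf_iff)
  also have "\<dots> = ennreal (\<Sum>y\<in>insert (butlast x) ?C. l ^ length y * pmf (biased_step l T x) y)"
    using assms(4) by (subst sum_ennreal[symmetric]) (auto simp: ennreal_mult)
  also have "(\<Sum>y\<in>insert (butlast x) ?C. l ^ length y * pmf (biased_step l T x) y)
      = l ^ k * (l / (?n + l)) + (\<Sum>y\<in>?C. l ^ Suc (Suc k) * (1 / (?n + l)))"
  proof (subst sum.insert[OF fin nin], intro arg_cong2[where f = "(+)"] sum.cong refl)
    show "l ^ length (butlast x) * pmf (biased_step l T x) (butlast x) = l ^ k * (l / (?n + l))"
      by (simp add: pmf k)
  next
    fix y assume y: "y \<in> ?C"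
    then have "y \<noteq> butlast x" using nin by blast
    moreover have "length y = Suc (Suc k)" using y k by (auto simp: children_def)
    ultimately show "l ^ length y * pmf (biased_step l T x) y = l ^ Suc (Suc k) * (1 / (?n + l))"
      using y by (simp add: pmf)
  qed
  also have "\<dots> = l ^ length x * ((1 + ?n * l) / (?n + l))"
    by (simp add: k nu_def add_divide_distrib distrib_left mult_ac)
  also have "\<dots> \<le> l ^ length x * 1"
  proof (rule mult_left_mono)
    have "(1 - l) * (?n - 1) \<ge> 0" using n assms by simp
    then show "(1 + ?n * l) / (?n + l) \<le> 1" using n assms by (simp add: field_simps)
  qed (use assms in simp)
  finally show ?thesis by (simp add: ennreal_leI)
qed

lemma beta_le_1: "beta l T \<le> 1"
  unfolding beta_def biased_walk_def
  by (intro prob_space.prob_le_1 prob_space_markov_chain)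

text \<open>
  The starting point lies one level below the target, so the target is hit with probability at
  most \<open>l\<close>.
\<close>

lemma beta_ge:
  assumes "T \<in> trees" "0 < l" "l < 1"
  shows "beta l T \<ge> 1 - l"
proof -
  let ?S = "star_tree T"
  let ?M = "biased_walk l ?S [0]"
  interpret M: prob_space ?M unfolding biased_walk_def by (rule prob_space_markov_chain)
  have S: "?S \<in> trees" by (rule star_tree_in_trees) fact
  have "[0] \<in> ?S" using assms(1) by (auto simp: star_tree_def trees_def)
  then have "emeasure ?M {X. \<exists>n. X n = []} \<le> ennreal (l ^ length [0::nat])"
    unfolding biased_walk_def
    by (rule markov_chain_hitting_le[where h = "\<lambda>x. ennreal (l ^ length x)"])
       (use S assms set_pmf_biased_step biased_step_superharmonic in auto)
  then have "M.prob {X. \<exists>n. X n = []} \<le> l"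
    using assms by (simp add: M.emeasure_eq_measure)
  moreover have "{X. \<exists>n. X n = []} \<in> sets ?M"
  proof -
    have "{X \<in> space (\<Pi>\<^sub>M n\<in>UNIV. count_space (UNIV :: vertex set)). \<exists>n::nat. X n = []}
        \<in> sets (\<Pi>\<^sub>M n\<in>UNIV. count_space UNIV)"
      by measurable
    then show ?thesis by (simp add: biased_walk_def space_PiM PiE_UNIV_domain)
  qed
  then have "M.prob {X. \<forall>n. X n \<noteq> []} = 1 - M.prob {X. \<exists>n. X n = []}"
    by (subst M.prob_compl[symmetric]) (auto simp: biased_walk_def intro!: arg_cong2[where f=measure])
  ultimately show ?thesis by (simp add: beta_def)
qed

lemma total_conductance_root:
  assumes "T \<in> trees"
  shows "total_conductance (tree_conductance l T) [] = real (nu T [])"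
proof -
  have root: "[] \<in> T" using assms by (simp add: trees_def)
  have "total_conductance (tree_conductance l T) [] = (\<Sum>\<^sub>\<infinity>y\<in>children T []. 1)"
    unfolding total_conductance_def
    by (intro infsum_cong_neutral) (use root in \<open>auto simp: tree_conductance_def children_def\<close>)
  then show ?thesis using finite_children[OF assms root] by (simp add: nu_def)
qed

lemma conductance_le:
  assumes "T \<in> trees"
  shows "conductance l T \<le> real (nu T [])"
  unfolding conductance_def effective_conductance_def total_conductance_root[OF assms]
  by (intro mult_left_le prob_space.prob_le_1 prob_space_markov_chain) simp

text \<open>
  Each child of the root lies on level \<open>1\<close>, so the walk returns to the root with probability at
  most \<open>l\<close>. The network walk agrees with the biased walk on the vertices of the tree,
  and it never leaves them.
\<close>

lemma conductance_ge:
  assumes "T \<in> trees" "0 < l" "l < 1"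
  shows "conductance l T \<ge> real (nu T []) * (1 - l)"
proof -
  let ?K = "network_step (tree_conductance l T)"
  let ?M = "markov_chain ?K []"
  interpret M: prob_space ?M by (rule prob_space_markov_chain)
  have K: "?K x = biased_step l T x" if "x \<in> T" for x
    using network_step_tree_conductance[OF assms(1) that assms(2)] .
  have root: "[] \<in> T" using assms(1) by (simp add: trees_def)
  have "emeasure ?M {X. \<exists>n>0. X n = []} \<le> ennreal l"
  proof (rule markov_chain_return_le[where h = "\<lambda>x. ennreal (l ^ length x)" and S = T])
    fix y assume "y \<in> set_pmf (?K [])"
    then have "y \<in> children T []" using K[OF root] set_pmf_biased_step_root[OF assms(1)] by simp
    then show "y \<in> T \<and> ennreal (l ^ length y) \<le> ennreal l" by (auto simp: children_def)
  qed (use K assms set_pmf_biased_step biased_step_superharmonic in auto)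
  then have "M.prob {X. \<exists>n>0. X n = []} \<le> l"
    using assms by (simp add: M.emeasure_eq_measure)
  moreover have "{X. \<exists>n>0. X n = []} \<in> sets ?M"
  proof -
    have "{X \<in> space (\<Pi>\<^sub>M n\<in>UNIV. count_space (UNIV :: vertex set)). \<exists>n::nat. n > 0 \<and> X n = []}
        \<in> sets (\<Pi>\<^sub>M n\<in>UNIV. count_space UNIV)"
      by measurable
    then show ?thesis by (simp add: space_PiM PiE_UNIV_domain)
  qed
  then have "M.prob {X. \<forall>n>0. X n \<noteq> []} = 1 - M.prob {X. \<exists>n>0. X n = []}"
    by (subst M.prob_compl[symmetric]) (auto intro!: arg_cong2[where f=measure])
  ultimately show ?thesis
    unfolding conductance_def effective_conductance_def total_conductance_root[OF assms(1)]
    by (intro mult_left_mono) auto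
qed

text \<open>
  As the bias vanishes, \<open>beta\<close> tends to \<open>1\<close> and the conductance to the number of children of the
  root, so numerator and denominator of the weight become equal. The bounds make this
  uniform over all pairs of trees. The upper bound uses that
  \<open>l - 1 + beta l T \<ge> 0\<close>, and \<open>l + n \<le> (l + 1) * n\<close> for \<open>n \<ge> 1\<close>.
\<close>

lemma agw_weight_bounds:
  assumes "T \<in> trees" "T' \<in> trees" "0 < l" "l < 1"
  shows "1 - l \<le> agw_weight l T T'" "agw_weight l T T' \<le> (1 + l) / (1 - l)"
proof -
  define n b c where "n = real (nu T' [])" and "b = beta l T" and "c = conductance l T'"
  have n: "n \<ge> 1" using nu_pos[of T' "[]"] assms(2) by (auto simp: n_def trees_def)
  have b: "1 - l \<le> b" "b \<le> 1" using beta_ge[OF assms(1,3,4)] beta_le_1 by (auto simp: b_def)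
  have c: "n * (1 - l) \<le> c" "c \<le> n"
    using conductance_ge[OF assms(2,3,4)] conductance_le[OF assms(2)] by (auto simp: n_def c_def)
  have w: "agw_weight l T T' = (l + n) * b / (l - 1 + b + c)"
    by (simp add: agw_weight_def n_def b_def c_def)
  have pos: "0 < n * (1 - l)" using n assms by simp
  have "(1 - l) * (l - 1 + b + c) \<le> (1 - l) * (l + n)"
    using assms b c by (intro mult_left_mono) auto
  also have "\<dots> \<le> b * (l + n)"
    using assms b n by (intro mult_right_mono) auto
  finally show "1 - l \<le> agw_weight l T T'"
    using pos b c by (simp add: w field_simps)
  have "(l + n) * b / (l - 1 + b + c) \<le> (l + n) * 1 / (n * (1 - l))"
    using assms b c n pos by (intro frac_le mult_left_mono) auto
  also have "\<dots> \<le> (l * n + n) / (n * (1 - l))"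
    using assms n pos by (intro divide_right_mono) auto
  also have "l * n + n = n * (1 + l)" by (simp add: algebra_simps)
  also have "n * (1 + l) / (n * (1 - l)) = (1 + l) / (1 - l)" using n by simp
  finally show "agw_weight l T T' \<le> (1 + l) / (1 - l)" by (simp add: w)
qed

section \<open>Measurability of tree functionals\<close>

lemma space_tree_space [simp]: "space tree_space = trees"
  unfolding tree_space_def by (rule space_measure_of) auto

lemma measurable_vertex_mem [measurable]: "Measurable.pred tree_space (\<lambda>T. u \<in> T)"
proof -
  have "{T \<in> trees. u \<in> T} \<in> sets tree_space"
    unfolding tree_space_def by (rule in_measure_of) auto
  then show ?thesis by (simp add: pred_def)
qed

lemma measurable_tree_spaceI:
  assumes "\<And>x. x \<in> space M \<Longrightarrow> f x \<in> trees"
    and "\<And>u. Measurable.pred M (\<lambda>x. u \<in> f x)"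
  shows "f \<in> measurable M tree_space"
  unfolding tree_space_def
proof (rule measurable_measure_of)
  fix A assume "A \<in> range (\<lambda>u. {T \<in> trees. u \<in> T})"
  then obtain u where "A = {T \<in> trees. u \<in> T}" by auto
  then have "f -` A \<inter> space M = {x \<in> space M. u \<in> f x}" using assms(1) by auto
  then show "f -` A \<inter> space M \<in> sets M" using assms(2)[of u] by (simp add: pred_def)
qed (use assms(1) in auto)

lemma measurable_nu [measurable]: "(\<lambda>T. nu T u) \<in> measurable tree_space (count_space UNIV)"
proof -
  have "nu T u = (LEAST k. u @ [k] \<notin> T)" if "T \<in> trees" for T
    using child_in_tree_iff[OF that] by (intro Least_equality[symmetric]) (auto simp: not_less)
  then show ?thesis by (subst measurable_cong[where g = "\<lambda>T. LEAST k. u @ [k] \<notin> T"]) auto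
qed

lemma measurable_children_mem [measurable]: "Measurable.pred tree_space (\<lambda>T. v \<in> children T u)"
  unfolding children_def by simp

text \<open>
  The kernel must be measurable at every word \<open>x\<close>, also for trees that do not contain \<open>x\<close>.
  At such a word the step does not depend on the tree any more, because the word has no children,
  so its value enters only as a constant.
\<close>

lemma measurable_pmf_biased_step:
  assumes "l > 0"
  shows "(\<lambda>T. pmf (biased_step l T x) y) \<in> borel_measurable tree_space"
proof (cases "x = []")
  case True
  have "pmf (biased_step l T x) y = (if y \<in> children T [] then 1 / real (nu T []) else 0)"
    if "T \<in> trees" for T
    using finite_children[OF that, of "[]"] children_nonempty[OF that, of "[]"] that True
    by (simp add: biased_step_def trees_def nu_def)
  then show ?thesis
    by (subst measurable_cong[where g = "\<lambda>T. if y \<in> children T [] then 1 / real (nu T []) else 0"]) auto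
next
  case False
  define c where
    "c = pmf (embed_pmf (\<lambda>y. if y = butlast x then l / (0 + l) else (0::real))) y"
  let ?g = "\<lambda>T. if x \<in> T
       then if y = butlast x then l / (real (nu T x) + l)
            else if y \<in> children T x then 1 / (real (nu T x) + l) else 0
       else c"
  have "pmf (biased_step l T x) y = ?g T" if T: "T \<in> trees" for T
  proof (cases "x \<in> T")
    case True
    then show ?thesis using pmf_biased_step[OF T True False assms] by simp
  next
    case outside: False
    then have "children T x = {}" using T by (auto simp: trees_def children_def)
    moreover from this have "nu T x = 0" by (simp add: nu_def)
    ultimately show ?thesis
      using False outside by (simp add: biased_step_def c_def cong: if_cong)
  qed
  moreover have "?g \<in> borel_measurable tree_space" by measurable
  ultimately show ?thesis by (subst measurable_cong[where g = ?g]) auto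
qed

lemma measurable_biased_walk:
  assumes "l > 0"
  shows "(\<lambda>T. biased_walk l T x) \<in> measurable tree_space (prob_algebra (\<Pi>\<^sub>M n\<in>UNIV. count_space UNIV))"
  unfolding biased_walk_def by (intro measurable_markov_chain measurable_pmf_biased_step assms)

text \<open>
  This makes the harmonic measure a probability kernel, as the iterated sampling in the definition
  of \<open>coupling\<close> presupposes.
\<close>

lemma measurable_harmonic_measure:
  assumes "l > 0"
  shows "harmonic_measure l \<in> measurable tree_space (prob_algebra ray_space)"
proof -
  have "(\<lambda>T. distr (biased_walk l T []) ray_space loop_erasure) \<in> measurable tree_space (prob_algebra ray_space)"
    unfolding ray_space_def
    by (intro measurable_compose[OF measurable_biased_walk[OF assms]]
              measurable_distr_prob_space measurable_loop_erasure)
  then show ?thesis by (simp add: harmonic_measure_def[abs_def])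
qed

lemma measurable_star_tree: "star_tree \<in> measurable tree_space tree_space"
proof (rule measurable_tree_spaceI)
  fix u :: vertex
  have "u \<in> star_tree T \<longleftrightarrow> (case u of [] \<Rightarrow> True | i # v \<Rightarrow> i = 0 \<and> v \<in> T)" for T
    by (auto simp: star_tree_def split: list.split)
  then show "Measurable.pred tree_space (\<lambda>T. u \<in> star_tree T)" by (cases u) simp_all
qed (simp add: star_tree_in_trees)

lemma measurable_beta:
  assumes "l > 0"
  shows "beta l \<in> borel_measurable tree_space"
proof -
  have "{X \<in> space (\<Pi>\<^sub>M n\<in>UNIV. count_space (UNIV :: vertex set)). \<forall>n::nat. X n \<noteq> []}
      \<in> sets (\<Pi>\<^sub>M n\<in>UNIV. count_space UNIV)"
    by measurable
  then have "{X. \<forall>n::nat. X n \<noteq> []} \<in> sets (\<Pi>\<^sub>M n\<in>UNIV. count_space (UNIV :: vertex set))"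
    by (simp add: space_PiM PiE_UNIV_domain)
  then show ?thesis
    unfolding beta_def[abs_def]
    by (intro measurable_compose[OF measurable_compose[OF measurable_star_tree measurable_biased_walk[OF assms]]]
              measurable_measure_prob_algebra)
qed

text \<open>
  The network walk has the same kernel as the biased walk at the vertices of the tree. At all other
  words the conductances vanish, whichever the tree is, and the kernel is again a constant.
\<close>

lemma measurable_conductance:
  assumes "l > 0"
  shows "conductance l \<in> borel_measurable tree_space"
proof -
  let ?K = "\<lambda>T. network_step (tree_conductance l T)"
  have "(\<lambda>T. pmf (?K T x) y) \<in> borel_measurable tree_space" for x y
  proof -
    define c where "c = pmf (embed_pmf (\<lambda>y::vertex. 0 / (\<Sum>\<^sub>\<infinity>y::vertex. 0::real))) y"
    have "pmf (?K T x) y = (if x \<in> T then pmf (biased_step l T x) y else c)" if "T \<in> trees" for T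
    proof (cases "x \<in> T")
      case True
      then show ?thesis using network_step_tree_conductance[OF that True assms] by simp
    next
      case False
      then have "tree_conductance l T x = (\<lambda>y. 0)" by (auto simp: tree_conductance_def)
      with False show ?thesis
        by (simp add: network_step_def total_conductance_def c_def)
    qed
    moreover have "(\<lambda>T. if x \<in> T then pmf (biased_step l T x) y else c) \<in> borel_measurable tree_space"
      using measurable_pmf_biased_step[OF assms] by measurable
    ultimately show ?thesis
      by (subst measurable_cong[where g = "\<lambda>T. if x \<in> T then pmf (biased_step l T x) y else c"]) auto
  qed
  then have K: "(\<lambda>T. markov_chain (?K T) []) \<in> measurable tree_space (prob_algebra (\<Pi>\<^sub>M n\<in>UNIV. count_space UNIV))"
    by (rule measurable_markov_chain)
  have "{X \<in> space (\<Pi>\<^sub>M n\<in>UNIV. count_space (UNIV :: vertex set)). \<forall>n::nat. n > 0 \<longrightarrow> X n \<noteq> []}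
      \<in> sets (\<Pi>\<^sub>M n\<in>UNIV. count_space UNIV)"
    by measurable
  then have "{X. \<forall>n::nat>0. X n \<noteq> []} \<in> sets (\<Pi>\<^sub>M n\<in>UNIV. count_space (UNIV :: vertex set))"
    by (simp add: space_PiM PiE_UNIV_domain)
  then have escape: "(\<lambda>T. measure (markov_chain (?K T) []) {X. \<forall>n>0. X n \<noteq> []}) \<in> borel_measurable tree_space"
    by (intro measurable_compose[OF K] measurable_measure_prob_algebra)
  have "conductance l T = real (nu T []) * measure (markov_chain (?K T) []) {X. \<forall>n>0. X n \<noteq> []}"
    if "T \<in> trees" for T
    using total_conductance_root[OF that] by (simp add: conductance_def effective_conductance_def)
  moreover have "(\<lambda>T. real (nu T []) * measure (markov_chain (?K T) []) {X. \<forall>n>0. X n \<noteq> []})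
      \<in> borel_measurable tree_space"
    using escape by measurable
  ultimately show ?thesis
    by (subst measurable_cong[where g = "\<lambda>T. real (nu T []) * measure (markov_chain (?K T) []) {X. \<forall>n>0. X n \<noteq> []}"]) auto
qed

lemma measurable_agw_weight:
  assumes "l > 0"
  shows "(\<lambda>(T, T'). agw_weight l T T') \<in> borel_measurable (tree_space \<Otimes>\<^sub>M tree_space)"
proof -
  note [measurable] = measurable_beta[OF assms] measurable_conductance[OF assms]
  show ?thesis unfolding agw_weight_def by measurable
qed

lemma mem_join_iff:
  "u \<in> join T T' \<longleftrightarrow>
     (case u of [] \<Rightarrow> True | i # v \<Rightarrow> (case i of 0 \<Rightarrow> v \<in> T | Suc j \<Rightarrow> j # v \<in> T'))"
  by (auto simp: join_def split: list.split nat.split)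

lemma join_in_trees:
  assumes "T \<in> trees" "T' \<in> trees"
  shows "join T T' \<in> trees"
proof -
  have T: "[] \<in> T" "\<And>u i. u @ [i] \<in> T \<Longrightarrow> u \<in> T"
    "\<And>u. u \<in> T \<Longrightarrow> \<exists>k>0. {i. u @ [i] \<in> T} = {..<k}"
    using assms(1) by (auto simp: trees_def)
  have T': "[] \<in> T'" "\<And>u i. u @ [i] \<in> T' \<Longrightarrow> u \<in> T'"
    "\<And>u. u \<in> T' \<Longrightarrow> \<exists>k>0. {i. u @ [i] \<in> T'} = {..<k}"
    using assms(2) by (auto simp: trees_def)
  show ?thesis
    unfolding trees_def
  proof (intro CollectI conjI allI impI ballI)
    fix u i assume "u @ [i] \<in> join T T'"
    then show "u \<in> join T T'"
    proof (cases u)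
      case (Cons j v)
      then show ?thesis
        using \<open>u @ [i] \<in> join T T'\<close> T(2)[of v i] T'(2)[of "(j - 1) # v" i]
        by (cases j) (simp_all add: mem_join_iff)
    qed (simp add: mem_join_iff)
  next
    fix u assume u: "u \<in> join T T'"
    show "\<exists>k>0. {i. u @ [i] \<in> join T T'} = {..<k}"
    proof (cases u)
      case Nil
      have "[i] \<in> join T T' \<longleftrightarrow> i < Suc (nu T' [])" for i
        using T(1) child_in_tree_iff[OF assms(2), of "[]" "i - 1"]
        by (cases i) (simp_all add: mem_join_iff)
      then show ?thesis
        unfolding Nil by (intro exI[of _ "Suc (nu T' [])"]) (simp add: lessThan_def)
    next
      case (Cons j v)
      then show ?thesis
        using u T(3)[of v] T'(3)[of "(j - 1) # v"] by (cases j) (simp_all add: mem_join_iff)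
    qed
  qed (simp add: mem_join_iff)
qed

lemma nu_plus_join:
  assumes "T \<in> trees" "T' \<in> trees"
  shows "nu_plus (join T T') = real (nu T' [])"
proof -
  have "i < nu (join T T') [] \<longleftrightarrow> i < Suc (nu T' [])" for i
    using child_in_tree_iff[OF join_in_trees[OF assms], of "[]" i] child_in_tree_iff[OF assms(2), of "[]"] assms(1)
    by (cases i) (auto simp: mem_join_iff trees_def)
  then have "nu (join T T') [] = Suc (nu T' [])"
    by (metis linorder_neqE_nat order_less_irrefl)
  then show ?thesis by (simp add: nu_plus_def)
qed

lemma measurable_join [measurable]:
  "(\<lambda>(T, T'). join T T') \<in> measurable (tree_space \<Otimes>\<^sub>M tree_space) tree_space"
proof (rule measurable_tree_spaceI)
  fix u :: vertex
  show "Measurable.pred (tree_space \<Otimes>\<^sub>M tree_space) (\<lambda>x. u \<in> (case x of (T, T') \<Rightarrow> join T T'))"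
  proof (cases u)
    case (Cons i v)
    then show ?thesis by (cases i) (simp_all add: mem_join_iff split_beta')
  qed (simp add: mem_join_iff split_beta')
qed (auto simp: space_pair_measure join_in_trees)

lemma measurable_join_ray [measurable]: "join_ray \<in> measurable ray_space ray_space"
proof -
  have "(\<lambda>R. join_ray R n) \<in> measurable ray_space (count_space UNIV)" for n
    unfolding join_ray_def ray_space_def by (cases n) simp_all
  then show ?thesis
    unfolding ray_space_def by (intro measurable_PiM_single') (auto simp: PiE_UNIV_domain)
qed

section \<open>The mean offspring number of a Galton--Watson tree\<close>

lemma tree_of_counts_in_trees:
  assumes "\<And>u. n u \<ge> 1"
  shows "tree_of_counts n \<in> trees"
    and nu_tree_of_counts: "nu (tree_of_counts n) [] = n []"
proof -
  have step: "u @ [i] \<in> tree_of_counts n \<longleftrightarrow> u \<in> tree_of_counts n \<and> i < n u" for u i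
    by (auto simp: tree_of_counts_def nth_append less_Suc_eq)
  have root: "[] \<in> tree_of_counts n" by (simp add: tree_of_counts_def)
  show mem: "tree_of_counts n \<in> trees"
    unfolding trees_def
  proof (intro CollectI conjI allI impI ballI root)
    fix u assume "u \<in> tree_of_counts n"
    then show "\<exists>k>0. {i. u @ [i] \<in> tree_of_counts n} = {..<k}"
      using assms[of u] by (intro exI[of _ "n u"]) (auto simp: step)
  qed (simp add: step)
  have "i < nu (tree_of_counts n) [] \<longleftrightarrow> i < n []" for i
    using child_in_tree_iff[OF mem, of "[]" i] step[of "[]" i] root by simp
  then show "nu (tree_of_counts n) [] = n []"
    by (metis linorder_neqE_nat order_less_irrefl)
qed

lemma prob_space_offspring:
  assumes "pmf p 0 = 0"
  shows "prob_space (restrict_space (measure_pmf p) {1::nat..})"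
proof (rule prob_space_restrict_space)
  have "AE k in measure_pmf p. k \<in> {1..}"
    using assms by (auto simp: AE_measure_pmf_iff set_pmf_iff intro!: Suc_leI gr0I)
  then show "emeasure (measure_pmf p) {1..} = 1"
    by (rule measure_pmf.emeasure_eq_1_AE[rotated]) simp
qed simp

lemma measurable_tree_of_counts:
  "tree_of_counts \<in> measurable (\<Pi>\<^sub>M u\<in>UNIV. restrict_space (measure_pmf p) {1..}) tree_space"
proof (rule measurable_tree_spaceI)
  fix n :: "vertex \<Rightarrow> nat" assume "n \<in> space (\<Pi>\<^sub>M u\<in>UNIV. restrict_space (measure_pmf p) {1::nat..})"
  then have "\<And>u. n u \<ge> 1" by (auto simp: space_PiM space_restrict_space PiE_UNIV_domain)
  then show "tree_of_counts n \<in> trees" by (rule tree_of_counts_in_trees)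
next
  fix u :: vertex
  let ?P = "\<Pi>\<^sub>M u\<in>UNIV. restrict_space (measure_pmf p) {1::nat..}"
  have [measurable]: "(\<lambda>n. n v) \<in> measurable ?P (count_space UNIV)" for v
    by (rule measurable_compose[OF measurable_component_singleton]) (auto intro: measurable_restrict_space1)
  show "Measurable.pred ?P (\<lambda>n. u \<in> tree_of_counts n)"
    unfolding tree_of_counts_def mem_Collect_eq by measurable
qed

lemma sets_GW [simp, measurable_cong]: "sets (GW p) = sets tree_space"
  and space_GW [simp]: "space (GW p) = trees"
  by (simp_all add: GW_def)

lemma prob_space_GW:
  assumes "pmf p 0 = 0"
  shows "prob_space (GW p)"
  unfolding GW_def
  by (intro prob_space.prob_space_distr prob_space_PiM prob_space_offspring measurable_tree_of_counts assms)

text \<open>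
  The offspring number of the root is the coordinate of the i.i.d. family at the empty word.
\<close>

lemma nn_integral_nu_GW:
  assumes "pmf p 0 = 0" "(\<lambda>k. real k * pmf p k) sums m"
  shows "(\<integral>\<^sup>+T. ennreal (real (nu T [])) \<partial>GW p) = ennreal m"
proof -
  let ?R = "restrict_space (measure_pmf p) {1::nat..}"
  let ?P = "\<Pi>\<^sub>M u\<in>(UNIV :: vertex set). ?R"
  have "(\<integral>\<^sup>+T. ennreal (real (nu T [])) \<partial>GW p) = (\<integral>\<^sup>+n. ennreal (real (nu (tree_of_counts n) [])) \<partial>?P)"
    unfolding GW_def by (rule nn_integral_distr[OF measurable_tree_of_counts]) measurable
  also have "\<dots> = (\<integral>\<^sup>+n. ennreal (real (n [])) \<partial>?P)"
    by (intro nn_integral_cong)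
       (auto simp: space_PiM space_restrict_space PiE_UNIV_domain intro!: nu_tree_of_counts)
  also have "\<dots> = (\<integral>\<^sup>+k. ennreal (real k) \<partial>distr ?P ?R (\<lambda>n. n []))"
    by (rule nn_integral_distr[symmetric])
       (auto intro!: measurable_component_singleton measurable_restrict_space1)
  also have "\<dots> = (\<integral>\<^sup>+k. ennreal (real k) \<partial>?R)"
    by (subst distr_PiM_component) (rule prob_space_offspring[OF assms(1)] refl UNIV_I)+
  also have "\<dots> = (\<integral>\<^sup>+k. ennreal (real k) * indicator {1..} k \<partial>measure_pmf p)"
    by (rule nn_integral_restrict_space) simp
  also have "\<dots> = (\<integral>\<^sup>+k. ennreal (real k * pmf p k) \<partial>count_space UNIV)"
    unfolding nn_integral_measure_pmf
    by (intro nn_integral_cong) (auto simp: indicator_def ennreal_mult mult.commute not_le)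
  also have "\<dots> = ennreal m"
    unfolding nn_integral_count_space_nat using assms(2)
    by (subst suminf_ennreal2) (auto simp: sums_iff)
  finally show ?thesis .
qed

section \<open>The augmented measure\<close>

text \<open>
  A function that ignores the ray integrates as if the ray were not sampled, because the harmonic
  measure of every tree has total mass \<open>1\<close>. It remains to carry this through the nested binds.
\<close>

lemma
  assumes "l > 0" "pmf p 0 = 0"
  shows sets_coupling: "sets (coupling p l) = sets (tree_space \<Otimes>\<^sub>M tree_space \<Otimes>\<^sub>M ray_space)"
    and nn_integral_coupling:
      "f \<in> borel_measurable (tree_space \<Otimes>\<^sub>M tree_space) \<Longrightarrow>
       (\<integral>\<^sup>+(T, T', R). f (T, T') \<partial>coupling p l) = (\<integral>\<^sup>+x. f x \<partial>(GW p \<Otimes>\<^sub>M GW p))"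
proof -
  let ?N = "tree_space \<Otimes>\<^sub>M tree_space \<Otimes>\<^sub>M ray_space"
  note H [measurable] = measurable_harmonic_measure[OF assms(1)]
  interpret G: prob_space "GW p" by (rule prob_space_GW) fact
  have GW_in [measurable]: "GW p \<in> space (prob_algebra tree_space)"
    using G.prob_space_axioms by (simp add: space_prob_algebra)
  define K3 where "K3 T T' = harmonic_measure l T \<bind> (\<lambda>R. return ?N (T, T', R))" for T T'
  define K2 where "K2 T = GW p \<bind> K3 T" for T
  have K3: "(\<lambda>x. K3 (fst x) (snd x)) \<in> measurable (tree_space \<Otimes>\<^sub>M tree_space) (prob_algebra ?N)"
    unfolding K3_def by measurable
  have K2: "K2 \<in> measurable tree_space (prob_algebra ?N)"
    unfolding K2_def
    by (rule measurable_bind_prob_space2[OF measurable_const[OF GW_in]]) (use K3 in \<open>simp add: split_beta'\<close>)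
  have coupling: "coupling p l = GW p \<bind> K2"
    by (simp add: coupling_def K2_def[abs_def] K3_def[abs_def])
  have K2': "K2 \<in> measurable (GW p) (subprob_algebra ?N)"
    using measurable_prob_algebraD[OF K2] by simp
  show "sets (coupling p l) = sets ?N"
    unfolding coupling by (rule sets_bind[OF sets_kernel[OF K2'] G.not_empty])
  assume f [measurable]: "f \<in> borel_measurable (tree_space \<Otimes>\<^sub>M tree_space)"
  let ?f = "\<lambda>(T, T', R). f (T, T')"
  have f' [measurable]: "?f \<in> borel_measurable ?N" by measurable
  have inner: "(\<integral>\<^sup>+x. ?f x \<partial>K3 T T') = f (T, T')" if "T \<in> trees" "T' \<in> trees" for T T'
  proof -
    have HT: "prob_space (harmonic_measure l T)" "sets (harmonic_measure l T) = sets ray_space"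
      using measurable_space[OF H, of T] that by (auto simp: space_prob_algebra)
    have "(\<lambda>R. return ?N (T, T', R)) \<in> measurable ray_space (subprob_algebra ?N)"
      using that by (intro measurable_compose[OF _ return_measurable] measurable_Pair) simp_all
    then have ret: "(\<lambda>R. return ?N (T, T', R)) \<in> measurable (harmonic_measure l T) (subprob_algebra ?N)"
      using HT(2) by (simp cong: measurable_cong_sets)
    have "(\<integral>\<^sup>+x. ?f x \<partial>K3 T T') = (\<integral>\<^sup>+R. \<integral>\<^sup>+x. ?f x \<partial>return ?N (T, T', R) \<partial>harmonic_measure l T)"
      unfolding K3_def by (rule nn_integral_bind[OF f' ret])
    also have "\<dots> = (\<integral>\<^sup>+R. f (T, T') \<partial>harmonic_measure l T)"
      using that sets_eq_imp_space_eq[OF HT(2)]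
      by (intro nn_integral_cong) (subst nn_integral_return, auto simp: space_pair_measure)
    also have "\<dots> = f (T, T')"
      using prob_space.emeasure_space_1[OF HT(1)] by simp
    finally show ?thesis .
  qed
  have K3T: "K3 T \<in> measurable (GW p) (subprob_algebra ?N)" if "T \<in> trees" for T
  proof -
    have "(\<lambda>T'. K3 T T') \<in> measurable tree_space (prob_algebra ?N)"
      using measurable_compose[OF _ K3, of "\<lambda>T'. (T, T')" tree_space] that by simp
    from measurable_prob_algebraD[OF this] show ?thesis by simp
  qed
  have "(\<integral>\<^sup>+x. ?f x \<partial>coupling p l) = (\<integral>\<^sup>+T. \<integral>\<^sup>+x. ?f x \<partial>K2 T \<partial>GW p)"
    unfolding coupling by (rule nn_integral_bind[OF f' K2'])
  also have "\<dots> = (\<integral>\<^sup>+T. \<integral>\<^sup>+T'. \<integral>\<^sup>+x. ?f x \<partial>K3 T T' \<partial>GW p \<partial>GW p)"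
    unfolding K2_def by (intro nn_integral_cong nn_integral_bind[OF f'] K3T) simp
  also have "\<dots> = (\<integral>\<^sup>+T. \<integral>\<^sup>+T'. f (T, T') \<partial>GW p \<partial>GW p)"
    by (intro nn_integral_cong inner) simp_all
  also have "\<dots> = (\<integral>\<^sup>+x. f x \<partial>(GW p \<Otimes>\<^sub>M GW p))"
    by (intro G.nn_integral_fst) measurable
  finally show "(\<integral>\<^sup>+x. ?f x \<partial>coupling p l) = (\<integral>\<^sup>+x. f x \<partial>(GW p \<Otimes>\<^sub>M GW p))" .
qed

lemma distr_coupling:
  assumes "l > 0" "pmf p 0 = 0"
  shows "distr (coupling p l) (tree_space \<Otimes>\<^sub>M tree_space) (\<lambda>(T, T', R). (T, T')) = GW p \<Otimes>\<^sub>M GW p"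
proof (rule measure_eqI)
  note [measurable_cong] = sets_coupling[OF assms]
  fix A assume "A \<in> sets (distr (coupling p l) (tree_space \<Otimes>\<^sub>M tree_space) (\<lambda>(T, T', R). (T, T')))"
  then have A [measurable]: "A \<in> sets (tree_space \<Otimes>\<^sub>M tree_space)" by simp
  have "emeasure (distr (coupling p l) (tree_space \<Otimes>\<^sub>M tree_space) (\<lambda>(T, T', R). (T, T'))) A
      = (\<integral>\<^sup>+x. indicator A x \<partial>distr (coupling p l) (tree_space \<Otimes>\<^sub>M tree_space) (\<lambda>(T, T', R). (T, T')))"
    by simp
  also have "\<dots> = (\<integral>\<^sup>+(T, T', R). indicator A (T, T') \<partial>coupling p l)"
    by (subst nn_integral_distr) (simp_all add: split_beta')
  also have "\<dots> = (\<integral>\<^sup>+x. indicator A x \<partial>(GW p \<Otimes>\<^sub>M GW p))"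
    by (rule nn_integral_coupling[OF assms]) simp
  also have "\<dots> = emeasure (GW p \<Otimes>\<^sub>M GW p) A"
    by (rule nn_integral_indicator) simp
  finally show "emeasure (distr (coupling p l) (tree_space \<Otimes>\<^sub>M tree_space) (\<lambda>(T, T', R). (T, T'))) A
      = emeasure (GW p \<Otimes>\<^sub>M GW p) A" .
qed (simp cong: sets_pair_measure_cong)

text \<open>
  The root of \<open>join T T'\<close> has one child more than the root of \<open>T'\<close>, and \<open>nu_plus\<close> subtracts it
  again. Since the ray does not enter either, the integral reduces to one over a pair of independent
  Galton--Watson trees; the only trace of the augmentation is the normalised weight.
\<close>

lemma integral_nu_plus_AGW:
  assumes "0 < l" "l < 1" "pmf p 0 = 0" "0 < agw_const p l"
  shows "(\<integral>(T, \<xi>). nu_plus T \<partial>AGW p l) =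
    (\<integral>(T, T'). agw_weight l T T' / agw_const p l * real (nu T' []) \<partial>(GW p \<Otimes>\<^sub>M GW p))"
proof -
  let ?N = "tree_space \<Otimes>\<^sub>M tree_space \<Otimes>\<^sub>M ray_space"
  let ?c = "agw_const p l"
  let ?w = "\<lambda>(T, T', R :: ray). agw_weight l T T' / ?c"
  let ?g = "\<lambda>(T, T'). agw_weight l T T' / ?c * real (nu T' [])"
  let ?nu = "\<lambda>(T, \<xi> :: ray). nu_plus T"
  let ?J = "\<lambda>(T, T', R). (join T T', join_ray R)"
  note [measurable_cong] = sets_coupling[OF assms(1,3)]
  note [measurable] = measurable_agw_weight[OF assms(1)]
  have space: "space (coupling p l) = trees \<times> trees \<times> space ray_space"
    using sets_eq_imp_space_eq[OF sets_coupling[OF assms(1,3)]] by (simp add: space_pair_measure)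
  have nu_plus [measurable]: "?nu \<in> borel_measurable (tree_space \<Otimes>\<^sub>M ray_space)"
    unfolding nu_plus_def by measurable
  have w [measurable]: "?w \<in> borel_measurable ?N"
    by measurable
  have join [measurable]: "?J \<in> measurable ?N (tree_space \<Otimes>\<^sub>M ray_space)"
    by measurable
  have proj: "(\<lambda>(T, T', R). (T, T')) \<in> measurable ?N (tree_space \<Otimes>\<^sub>M tree_space)"
    by measurable
  have g: "?g \<in> borel_measurable (tree_space \<Otimes>\<^sub>M tree_space)"
    by measurable
  have coupling_meas: "measurable (coupling p l) M = measurable ?N M" for M :: "'b measure"
    by (rule measurable_cong_sets[OF sets_coupling[OF assms(1,3)] refl])
  have w_nonneg: "AE x in coupling p l. 0 \<le> ?w x"
  proof (rule AE_I2)
    fix x assume "x \<in> space (coupling p l)"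
    then obtain T T' R where x: "x = (T, T', R)" "T \<in> trees" "T' \<in> trees" using space by auto
    then have "0 \<le> agw_weight l T T'"
      using agw_weight_bounds(1)[of T T' l] assms(1,2) by simp
    then show "0 \<le> ?w x" using assms(4) x(1) by simp
  qed
  have "sets (density (coupling p l) (\<lambda>x. ennreal (?w x))) = sets ?N"
    using sets_coupling[OF assms(1,3)] by simp
  then have J: "?J \<in> measurable (density (coupling p l) (\<lambda>x. ennreal (?w x))) (tree_space \<Otimes>\<^sub>M ray_space)"
    using join by (subst measurable_cong_sets[OF _ refl, of _ ?N])
  have "AGW p l = distr (density (coupling p l) (\<lambda>x. ennreal (?w x))) (tree_space \<Otimes>\<^sub>M ray_space) ?J"
    unfolding AGW_def by (simp only: split_beta')
  then have "(\<integral>x. ?nu x \<partial>AGW p l) = (\<integral>x. ?nu (?J x) \<partial>density (coupling p l) (\<lambda>x. ennreal (?w x)))"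
    using integral_distr[OF J nu_plus] by (simp only:)
  also have "\<dots> = (\<integral>x. ?w x *\<^sub>R ?nu (?J x) \<partial>coupling p l)"
    by (rule integral_density[OF _ _ w_nonneg]) (simp_all only: coupling_meas w measurable_compose[OF join nu_plus])
  also have "\<dots> = (\<integral>x. ?g (case x of (T, T', R) \<Rightarrow> (T, T')) \<partial>coupling p l)"
    by (intro Bochner_Integration.integral_cong refl) (auto simp: space nu_plus_join)
  also have "\<dots> = (\<integral>x. ?g x \<partial>distr (coupling p l) (tree_space \<Otimes>\<^sub>M tree_space) (\<lambda>(T, T', R). (T, T')))"
    by (rule integral_distr[symmetric]) (simp_all only: coupling_meas proj g)
  finally show ?thesis unfolding distr_coupling[OF assms(1,3)] .
qed

lemma agw_const_bounds:
  assumes "0 < l" "l < 1" "pmf p 0 = 0"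
  shows "1 - l \<le> agw_const p l" "agw_const p l \<le> (1 + l) / (1 - l)"
proof -
  interpret G: prob_space "GW p" by (rule prob_space_GW) fact
  interpret P: pair_prob_space "GW p" "GW p" ..
  let ?P = "GW p \<Otimes>\<^sub>M GW p" and ?w = "\<lambda>(T, T'). agw_weight l T T'"
  have bounds: "1 - l \<le> ?w x" "?w x \<le> (1 + l) / (1 - l)" if "x \<in> space ?P" for x
    using that agw_weight_bounds assms by (auto simp: space_pair_measure)
  have "?w \<in> borel_measurable ?P"
    using measurable_agw_weight[OF assms(1)] by (simp cong: measurable_cong_sets sets_pair_measure_cong)
  then have int: "integrable ?P ?w"
    by (rule P.P.integrable_const_bound[where B = "(1 + l) / (1 - l)", rotated])
       (use bounds assms in \<open>force intro!: AE_I2\<close>)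
  show "1 - l \<le> agw_const p l"
    unfolding agw_const_def by (rule P.P.integral_ge_const[OF int]) (use bounds in auto)
  show "agw_const p l \<le> (1 + l) / (1 - l)"
    unfolding agw_const_def by (rule P.P.integral_le_const[OF int]) (use bounds in auto)
qed

text \<open>
  The quotient of the weight and its mean \<open>agw_const p l\<close> lies between the ratio of the lower to
  the upper bound of the weight and the inverse of this ratio.
\<close>

lemma integral_nu_plus_AGW_bounds:
  assumes "0 < l" "l < 1" "pmf p 0 = 0" "(\<lambda>k. real k * pmf p k) sums m"
  shows "(1 - l)\<^sup>2 / (1 + l) * m \<le> (\<integral>(T, \<xi>). nu_plus T \<partial>AGW p l)"
    and "(\<integral>(T, \<xi>). nu_plus T \<partial>AGW p l) \<le> (1 + l) / (1 - l)\<^sup>2 * m"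
proof -
  interpret G: prob_space "GW p" by (rule prob_space_GW) fact
  interpret P: pair_prob_space "GW p" "GW p" ..
  let ?P = "GW p \<Otimes>\<^sub>M GW p" and ?c = "agw_const p l"
  let ?nu = "\<lambda>(T :: tree, T'). real (nu T' [])"
  let ?g = "\<lambda>(T, T'). agw_weight l T T' / ?c * real (nu T' [])"
  note c = agw_const_bounds[OF assms(1-3)]
  have c_pos: "0 < ?c" using c(1) assms(2) by simp
  have m: "0 \<le> m"
    using sums_le[OF _ sums_zero assms(4)] by simp
  have nu_meas: "?nu \<in> borel_measurable ?P" by measurable
  have g_meas: "?g \<in> borel_measurable ?P"
  proof -
    note [measurable] = measurable_agw_weight[OF assms(1)]
    show ?thesis by measurable
  qed
  have "(\<integral>\<^sup>+x. ennreal (?nu x) \<partial>?P) = (\<integral>\<^sup>+T. \<integral>\<^sup>+T'. ennreal (?nu (T, T')) \<partial>GW p \<partial>GW p)"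
    using nu_meas by (intro G.nn_integral_fst[symmetric]) measurable
  also have "\<dots> = ennreal m"
    by (simp add: nn_integral_nu_GW[OF assms(3,4)] G.emeasure_space_1[simplified])
  finally have nu: "integrable ?P ?nu" "integral\<^sup>L ?P ?nu = m"
    using nn_integral_eq_integrable[OF nu_meas _ m] by (auto simp: split_beta')
  have bounds: "(1 - l)\<^sup>2 / (1 + l) * ?nu x \<le> ?g x" "?g x \<le> (1 + l) / (1 - l)\<^sup>2 * ?nu x"
    if "x \<in> space ?P" for x
  proof -
    obtain T T' where x: "x = (T, T')" "T \<in> trees" "T' \<in> trees"
      using \<open>x \<in> space ?P\<close> by (auto simp: space_pair_measure)
    note w = agw_weight_bounds[OF x(2,3) assms(1,2)]
    have "(1 - l) / ((1 + l) / (1 - l)) \<le> agw_weight l T T' / ?c"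
      using w c c_pos assms by (intro frac_le) auto
    then have "(1 - l)\<^sup>2 / (1 + l) \<le> agw_weight l T T' / ?c"
      by (simp add: power2_eq_square)
    moreover have "agw_weight l T T' / ?c \<le> ((1 + l) / (1 - l)) / (1 - l)"
      using w c c_pos assms by (intro frac_le) auto
    then have "agw_weight l T T' / ?c \<le> (1 + l) / (1 - l)\<^sup>2"
      by (simp add: power2_eq_square)
    ultimately show "(1 - l)\<^sup>2 / (1 + l) * ?nu x \<le> ?g x" "?g x \<le> (1 + l) / (1 - l)\<^sup>2 * ?nu x"
      by (simp_all only: x(1) prod.case mult_right_mono of_nat_0_le_iff)
  qed
  have g_nonneg: "0 \<le> ?g x" if "x \<in> space ?P" for x
  proof -
    have "0 \<le> (1 - l)\<^sup>2 / (1 + l) * ?nu x" using assms by (cases x) simp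
    then show ?thesis using bounds(1)[OF that] by (rule order_trans)
  qed
  have g: "integrable ?P ?g"
  proof (rule Bochner_Integration.integrable_bound[OF integrable_mult_right[OF nu(1), of "(1 + l) / (1 - l)\<^sup>2"] g_meas])
    show "AE x in ?P. norm (?g x) \<le> norm ((1 + l) / (1 - l)\<^sup>2 * ?nu x)"
    proof (rule AE_I2)
      fix x assume "x \<in> space ?P"
      from g_nonneg[OF this] bounds(2)[OF this]
      show "norm (?g x) \<le> norm ((1 + l) / (1 - l)\<^sup>2 * ?nu x)"
        unfolding real_norm_def
        by (rule order_trans[OF eq_refl[OF abs_of_nonneg] order_trans[OF _ abs_ge_self]])
    qed
  qed
  have "(1 - l)\<^sup>2 / (1 + l) * m = (\<integral>x. (1 - l)\<^sup>2 / (1 + l) * ?nu x \<partial>?P)"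
    using nu(2) by simp
  also have "\<dots> \<le> integral\<^sup>L ?P ?g"
    by (intro integral_mono integrable_mult_right nu g bounds)
  finally show "(1 - l)\<^sup>2 / (1 + l) * m \<le> (\<integral>(T, \<xi>). nu_plus T \<partial>AGW p l)"
    using integral_nu_plus_AGW[OF assms(1-3) c_pos] by simp
  have "integral\<^sup>L ?P ?g \<le> (\<integral>x. (1 + l) / (1 - l)\<^sup>2 * ?nu x \<partial>?P)"
    by (intro integral_mono integrable_mult_right nu g bounds)
  also have "\<dots> = (1 + l) / (1 - l)\<^sup>2 * m"
    using nu(2) by simp
  finally show "(\<integral>(T, \<xi>). nu_plus T \<partial>AGW p l) \<le> (1 + l) / (1 - l)\<^sup>2 * m"
    using integral_nu_plus_AGW[OF assms(1-3) c_pos] by simp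
qed

theorem proposition9:
  fixes p :: "nat pmf" and m :: real
  assumes "pmf p 0 = 0"
    and "\<And>k. k \<ge> 1 \<Longrightarrow> pmf p k < 1"
    and "(\<lambda>k. real k * pmf p k) sums m"
    and "1 < m"
  shows "((\<lambda>l. \<integral>(T, \<xi>). nu_plus T \<partial>AGW p l) \<longlongrightarrow> m) (at 0 within {0<..<m})"
proof -
  let ?F = "at (0::real) within {0<..<m}"
  have small: "\<forall>\<^sub>F l in ?F. 0 < l \<and> l < 1"
    unfolding eventually_at by (intro exI[of _ 1]) (auto simp: dist_real_def)
  show ?thesis
  proof (rule tendsto_sandwich)
    show "\<forall>\<^sub>F l in ?F. (1 - l)\<^sup>2 / (1 + l) * m \<le> (\<integral>(T, \<xi>). nu_plus T \<partial>AGW p l)"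
      using small by eventually_elim (use integral_nu_plus_AGW_bounds(1) assms(1,3) in blast)
    show "\<forall>\<^sub>F l in ?F. (\<integral>(T, \<xi>). nu_plus T \<partial>AGW p l) \<le> (1 + l) / (1 - l)\<^sup>2 * m"
      using small by eventually_elim (use integral_nu_plus_AGW_bounds(2) assms(1,3) in blast)
    have "((\<lambda>l. (1 - l)\<^sup>2 / (1 + l) * m) \<longlongrightarrow> (1 - 0)\<^sup>2 / (1 + 0) * m) ?F"
      by (intro tendsto_intros) simp_all
    then show "((\<lambda>l. (1 - l)\<^sup>2 / (1 + l) * m) \<longlongrightarrow> m) ?F" by simp
    have "((\<lambda>l. (1 + l) / (1 - l)\<^sup>2 * m) \<longlongrightarrow> (1 + 0) / (1 - 0)\<^sup>2 * m) ?F"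
      by (intro tendsto_intros) simp_all
    then show "((\<lambda>l. (1 + l) / (1 - l)\<^sup>2 * m) \<longlongrightarrow> m) ?F" by simp
  qed
qed

end
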